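(* The star graph $X_3=\mathrm{Cay}(\mathfrak S_4,\{(1,4),(2,4),(3,4)\})$ is an $\mathfrak S_3$-cover of the complete graph $K_4$, whose intermediate covers are isomorphic to the cube graph or the truncated tetrahedron graph.
   Context: $\mathfrak S_m$ is the symmetric group on $\{1,\dots,m\}$; permutations are composed as functions, $(\xi\tau)(j)=\xi(\tau(j))$. The Cayley graph $\mathrm{Cay}(G,S)$ (with $S=S^{-1}$, $1\notin S$) is the simple undirected graph with vertex set $G$ in which $\xi$ and $\eta$ are adjacent iff $\eta=\xi s$ for some $s\in S$. Cover: for finite simple graphs $\tilde X$ and $X$, a covering map $p:\tilde X\to X$ is a surjective graph morphism such that for every vertex $\tilde v$ of $\tilde X$, $p$ induces a bijection from the set of edges incident to $\tilde v$ to the set of edges incident to $p(\tilde v)$; $\tilde X$ is then a cover of $X$. Galois cover: a cover $p:\tilde X\to X$ is Galois if there is a group $G$ acting on $\tilde X$ (by graph automorphisms) that acts freely and transitively on each fiber $p^{-1}(w)$, $w\in V(X)$, and such that the quotient graph $\tilde X/G$ is isomorphic to $X$. Then $G$ is called the Galois group and $\tilde X$ is called a $G$-cover of $X$. The quotient graph has the $G$-orbits of vertices as vertices, two orbits being adjacent iff some representatives are adjacent. Intermediate cover: given a covering map $p:\tilde X\to X$, an intermediate cover is a graph $Y$ together with covering maps $q:\tilde X\to Y$ and $r:Y\to X$ such that $p=r\circ q$. Here the covering map $p:X_3\to K_4$ is given on vertices by $p(\xi)=\xi(4)$, where $V(K_4)=\{1,2,3,4\}$, and $\mathfrak S_3$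 is identified with the subgroup of $\mathfrak S_4$ fixing $4$, acting on $V(X_3)=\mathfrak S_4$ by right multiplication. The cube graph is the 1-skeleton of the 3-dimensional cube (8 vertices, 3-regular). The truncated tetrahedron graph is the 1-skeleton of the truncated tetrahedron (12 vertices, 3-regular).
   Formalization: "Intermediate covers" is read as proper ones (neither covering map q nor r is an isomorphism), since the star graph X_3 and K_4 themselves are intermediate covers by the definition but are neither the cube nor the truncated tetrahedron graph. *)

theory Defs
  imports
    "HOL-Analysis.Analysis"
    "HOL-Algebra.Sym_Groups"
    "HOL-Algebra.Group_Action"
begin

section \<open>Finite simple graphs\<close>

record 'a sgraph =
  verts :: "'a set"
  edges :: "'a set set"

definition simple_graph :: "'a sgraph \<Rightarrow> bool" where
  "simple_graph X \<longleftrightarrow>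
     finite (verts X) \<and>
     (\<forall>e\<in>edges X. \<exists>u\<in>verts X. \<exists>v\<in>verts X. u \<noteq> v \<and> e = {u, v})"

definition incident_edges :: "'a sgraph \<Rightarrow> 'a \<Rightarrow> 'a set set" where
  "incident_edges X v = {e \<in> edges X. v \<in> e}"

definition graph_morphism :: "'a sgraph \<Rightarrow> 'b sgraph \<Rightarrow> ('a \<Rightarrow> 'b) \<Rightarrow> bool" where
  "graph_morphism X Y f \<longleftrightarrow>
     (\<forall>v\<in>verts X. f v \<in> verts Y) \<and> (\<forall>e\<in>edges X. f ` e \<in> edges Y)"

definition graph_isomorphism :: "'a sgraph \<Rightarrow> 'b sgraph \<Rightarrow> ('a \<Rightarrow> 'b) \<Rightarrow> bool" where
  "graph_isomorphism X Y f \<longleftrightarrow>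
     bij_betw f (verts X) (verts Y) \<and> (\<lambda>e. f ` e) ` edges X = edges Y"

definition isomorphic_graphs :: "'a sgraph \<Rightarrow> 'b sgraph \<Rightarrow> bool" where
  "isomorphic_graphs X Y \<longleftrightarrow> (\<exists>f. graph_isomorphism X Y f)"

definition complete_graph :: "'a set \<Rightarrow> 'a sgraph" where
  "complete_graph V = \<lparr>verts = V, edges = {{u, v} | u v. u \<in> V \<and> v \<in> V \<and> u \<noteq> v}\<rparr>"

text \<open>Only meaningful for \<^term>\<open>S \<subseteq> carrier G\<close> closed under inverses and not containing the
  identity; the result is then a simple graph.\<close>

definition cayley_graph :: "('g, 'm) monoid_scheme \<Rightarrow> 'g set \<Rightarrow> 'g sgraph" where
  "cayley_graph G S =
     \<lparr>verts = carrier G, edges = {{x, x \<otimes>\<^bsub>G\<^esub> s} | x s. x \<in> carrier G \<and> s \<in> S}\<rparr>"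


section \<open>Covers\<close>

text \<open>Surjectivity is required on vertices; surjectivity on edges follows from it together with the
  bijectivity on incident edges.\<close>

definition covering_map :: "'a sgraph \<Rightarrow> 'b sgraph \<Rightarrow> ('a \<Rightarrow> 'b) \<Rightarrow> bool" where
  "covering_map X' X p \<longleftrightarrow>
     simple_graph X' \<and> simple_graph X \<and> graph_morphism X' X p \<and>
     p ` verts X' = verts X \<and>
     (\<forall>v\<in>verts X'. bij_betw (\<lambda>e. p ` e) (incident_edges X' v) (incident_edges X (p v)))"

definition fiber :: "'a sgraph \<Rightarrow> ('a \<Rightarrow> 'b) \<Rightarrow> 'b \<Rightarrow> 'a set" where
  "fiber X' p w = {v \<in> verts X'. p v = w}"

definition graph_action :: "('g, 'm) monoid_scheme \<Rightarrow> 'a sgraph \<Rightarrow> ('g \<Rightarrow> 'a \<Rightarrow> 'a) \<Rightarrow> bool" where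
  "graph_action G X \<phi> \<longleftrightarrow>
     group_action G (verts X) \<phi> \<and> (\<forall>g\<in>carrier G. graph_isomorphism X X (\<phi> g))"

definition acts_freely_transitively_on ::
    "('g, 'm) monoid_scheme \<Rightarrow> ('g \<Rightarrow> 'a \<Rightarrow> 'a) \<Rightarrow> 'a set \<Rightarrow> bool" where
  "acts_freely_transitively_on G \<phi> F \<longleftrightarrow>
     (\<forall>g\<in>carrier G. \<forall>v\<in>F. \<phi> g v \<in> F) \<and>
     (\<forall>g\<in>carrier G. \<forall>v\<in>F. \<phi> g v = v \<longrightarrow> g = \<one>\<^bsub>G\<^esub>) \<and>
     (\<forall>u\<in>F. \<forall>v\<in>F. \<exists>g\<in>carrier G. \<phi> g u = v)"

definition quotient_graph ::
    "('g, 'm) monoid_scheme \<Rightarrow> 'a sgraph \<Rightarrow> ('g \<Rightarrow> 'a \<Rightarrow> 'a) \<Rightarrow> 'a set sgraph" where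
  "quotient_graph G X \<phi> =
     \<lparr>verts = orbits G (verts X) \<phi>,
      edges = {{A, B} | A B. A \<in> orbits G (verts X) \<phi> \<and> B \<in> orbits G (verts X) \<phi> \<and> A \<noteq> B \<and>
                             (\<exists>a\<in>A. \<exists>b\<in>B. {a, b} \<in> edges X)}\<rparr>"

definition galois_cover ::
    "('g, 'm) monoid_scheme \<Rightarrow> ('g \<Rightarrow> 'a \<Rightarrow> 'a) \<Rightarrow> 'a sgraph \<Rightarrow> 'b sgraph \<Rightarrow> ('a \<Rightarrow> 'b) \<Rightarrow> bool" where
  "galois_cover G \<phi> X' X p \<longleftrightarrow>
     covering_map X' X p \<and> graph_action G X' \<phi> \<and>
     (\<forall>w\<in>verts X. acts_freely_transitively_on G \<phi> (fiber X' p w)) \<and>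
     isomorphic_graphs (quotient_graph G X' \<phi>) X"

definition intermediate_cover ::
    "'a sgraph \<Rightarrow> 'b sgraph \<Rightarrow> ('a \<Rightarrow> 'b) \<Rightarrow> 'c sgraph \<Rightarrow> ('a \<Rightarrow> 'c) \<Rightarrow> ('c \<Rightarrow> 'b) \<Rightarrow> bool" where
  "intermediate_cover X' X p Y q r \<longleftrightarrow>
     covering_map X' Y q \<and> covering_map Y X r \<and> (\<forall>v\<in>verts X'. p v = r (q v))"

text \<open>The trivial intermediate covers are \<^term>\<open>X'\<close> and \<^term>\<open>X\<close> themselves.\<close>

definition proper_intermediate_cover ::
    "'a sgraph \<Rightarrow> 'b sgraph \<Rightarrow> ('a \<Rightarrow> 'b) \<Rightarrow> 'c sgraph \<Rightarrow> ('a \<Rightarrow> 'c) \<Rightarrow> ('c \<Rightarrow> 'b) \<Rightarrow> bool" where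
  "proper_intermediate_cover X' X p Y q r \<longleftrightarrow>
     intermediate_cover X' X p Y q r \<and>
     \<not> graph_isomorphism X' Y q \<and> \<not> graph_isomorphism Y X r"


section \<open>The star graph over the complete graph on four vertices\<close>

definition star_graph_X3 :: "(nat \<Rightarrow> nat) sgraph" where
  "star_graph_X3 = 
     cayley_graph (sym_group 4)
       {Transposition.transpose 1 4, Transposition.transpose 2 4, Transposition.transpose 3 4}"

definition K4 :: "nat sgraph" where
  "K4 = complete_graph {1, 2, 3, 4}"

definition star_proj :: "(nat \<Rightarrow> nat) \<Rightarrow> nat" where
  "star_proj \<xi> = \<xi> 4"

text \<open>Elements of \<^term>\<open>sym_group 3\<close> are functions on all natural numbers that fix everything outside
  \<open>{1..3}\<close>, so its carrier literally is the subgroup of \<^term>\<open>sym_group 4\<close> fixing \<open>4\<close>.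
  The right action \<open>\<xi> \<mapsto> \<xi> \<sigma>\<close> is turned into a left action by inverting \<open>\<sigma>\<close>; the restriction is what
  \<^const>\<open>BijGroup\<close> requires.\<close>

definition right_mult_action :: "(nat \<Rightarrow> nat) \<Rightarrow> (nat \<Rightarrow> nat) \<Rightarrow> (nat \<Rightarrow> nat)" where
  "right_mult_action \<sigma> =
     (\<lambda>\<xi>\<in>carrier (sym_group 4). \<xi> \<otimes>\<^bsub>sym_group 4\<^esub> inv\<^bsub>sym_group 4\<^esub> \<sigma>)"


section \<open>Two polyhedral graphs\<close>

definition one_skeleton :: "'a::euclidean_space set \<Rightarrow> 'a sgraph" where
  "one_skeleton P =
     \<lparr>verts = {v. v extreme_point_of P}, edges = {{u, v} | u v. closed_segment u v edge_of P}\<rparr>"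

definition cube_graph :: "(real ^ 3) sgraph" where
  "cube_graph = one_skeleton (cbox 0 1)"

text \<open>Four alternating vertices of the cube with vertices \<open>(\<plusminus>1, \<plusminus>1, \<plusminus>1)\<close> span a regular tetrahedron.
  Cutting off its corners at one third of each edge leaves the convex hull of the points
  \<open>(2/3) a + (1/3) b\<close> for distinct vertices \<open>a\<close> and \<open>b\<close>.\<close>

definition tetrahedron_vertices :: "(real ^ 3) set" where
  "tetrahedron_vertices =
     {vector [1, 1, 1], vector [1, -1, -1], vector [-1, 1, -1], vector [-1, -1, 1]}"

definition truncated_tetrahedron :: "(real ^ 3) set" where
  "truncated_tetrahedron =
     convex hull {(2/3) *\<^sub>R a + (1/3) *\<^sub>R b | a b.
       a \<in> tetrahedron_vertices \<and> b \<in> tetrahedron_vertices \<and> a \<noteq> b}"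

definition truncated_tetrahedron_graph :: "(real ^ 3) sgraph" where
  "truncated_tetrahedron_graph = one_skeleton truncated_tetrahedron"

end

theory Submission
  imports Defs
begin

text \<open>Let \<open>q\<close> be the first map of an intermediate cover. Right multiplication by \<open>\<sigma>\<close> in
  \<open>S\<^sub>3\<close> commutes with lifting edges of \<open>K\<^sub>4\<close>, so by connectedness the set \<open>H\<close> of those \<open>\<sigma>\<close> with
  \<open>q (\<xi> \<sigma>) = q \<xi>\<close> is the same for every vertex \<open>\<xi>\<close>; it is a subgroup of \<open>S\<^sub>3\<close> and its cosets are the
  fibres of \<open>q\<close>. For a proper cover, \<open>H\<close> is the alternating group, whose cosets are told apart by
  \<open>\<xi> \<mapsto> (\<xi>(4), sgn \<xi>)\<close>, or the stabiliser of some \<open>k\<close>, whose cosets are told apart by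
  \<open>\<xi> \<mapsto> (\<xi>(k), \<xi>(4))\<close>. These labels form the graphs of the cube, with vertices \<open>\<plusminus>a\<close> for the vertices
  \<open>a\<close> of a regular tetrahedron, and of the truncated tetrahedron, with vertices
  \<open>(2/3) a + (1/3) b\<close>.\<close>

section \<open>Skeletons of polytopes\<close>

text \<open>Neither side of the wanted isomorphism is directly accessible: Y is any graph on any
  type, while the two target graphs are given by extreme points and edges of polytopes in real
  space. The labels are where the two sides meet. A covering map determines the edges of its target
  as images of edges, so two covers by the same graph with the same fibres have isomorphic targets,
  and all that matters about Y is a partition of \<open>verts star_graph_X3\<close>. The same labels
  are coordinates relative to a tetrahedron centred at the origin, where inner products depend only
  on which indices agree. Right multiplication by \<sigma> commutes with lifting because conjugation
  by \<sigma>, which fixes 4, turns the generator (j,4) into (\<sigma>(j),4). Properness is what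
  excludes the trivial subgroup and the whole of S_3, which would give X_3 and K_4 themselves. The
  stabilisers of 1, 2 and 3 are conjugate; accordingly they share one label graph, and only the
  labelling map depends on k.\<close>

definition labelled_graph :: "'i set \<Rightarrow> ('i \<Rightarrow> 'i \<Rightarrow> bool) \<Rightarrow> 'i sgraph" where
  "labelled_graph I adj = \<lparr>verts = I, edges = {{i, j} | i j. i \<in> I \<and> j \<in> I \<and> adj i j}\<rparr>"

text \<open>Equality on T extends to its affine hull because a hyperplane is affine, and strict
  inequality on the other points extends to their convex hull because an open half-space is convex;
  so the two hulls are disjoint.\<close>

lemma supporting_hyperplane_face_of_convex_hull:
  fixes S :: "'a::euclidean_space set"
  assumes "finite S" "T \<subseteq> S" and eq: "\<And>w. w \<in> T \<Longrightarrow> c \<bullet> w = \<beta>"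
    and less: "\<And>w. w \<in> S - T \<Longrightarrow> c \<bullet> w < \<beta>"
  shows "(convex hull T) face_of (convex hull S)"
proof (rule face_of_convex_hulls)
  have "affine hull T \<subseteq> {x. c \<bullet> x = \<beta>}"
    by (rule hull_minimal) (use eq in \<open>auto simp: affine_hyperplane\<close>)
  moreover have "convex hull (S - T) \<subseteq> {x. c \<bullet> x < \<beta>}"
    by (rule hull_minimal) (use less in \<open>auto simp: convex_halfspace_lt\<close>)
  ultimately show "affine hull T \<inter> convex hull (S - T) = {}"
    by fastforce
qed (use assms in auto)

text \<open>The edges of \<open>one_skeleton\<close> range over arbitrary pairs of points; this
  confines their ends to the generating set, since extreme points of a face are extreme in the whole
  polytope.\<close>

lemma segment_edge_of_endpoints:
  fixes u v :: "'a::euclidean_space"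
  assumes "closed_segment u v edge_of convex hull S"
  shows "u \<in> S" "v \<in> S" "u \<noteq> v"
proof -
  have face: "closed_segment u v face_of convex hull S" and dim: "aff_dim (closed_segment u v) = 1"
    using assms by (auto simp: edge_of_def)
  have "u extreme_point_of closed_segment u v" "v extreme_point_of closed_segment u v"
    by (simp_all add: extreme_point_of_segment)
  then show "u \<in> S" "v \<in> S"
    using extreme_point_of_face[OF face] extreme_point_of_convex_hull by blast+
  show "u \<noteq> v"
    using dim by auto
qed

lemma exchange_not_face_of:
  fixes u v w :: "'a::euclidean_space"
  assumes "w extreme_point_of P" "w \<noteq> u" "w \<noteq> v" "u + v - w \<in> P"
  shows "\<not> closed_segment u v face_of P"
proof
  assume face: "closed_segment u v face_of P"
  then have "closed_segment u v \<subseteq> P"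
    by (rule face_of_imp_subset)
  have "w \<notin> closed_segment u v"
    using assms(1-3) \<open>closed_segment u v \<subseteq> P\<close> ends_in_segment[of u v]
    by (auto simp: extreme_point_of_def closed_segment_eq_open)
  \<comment> \<open>Rules out w = u + v - w, in which case the open segment between the two would be
    empty.\<close>
  then have "midpoint u v \<noteq> w"
    by auto
  moreover have "midpoint u v = midpoint w (u + v - w)"
    by (simp add: midpoint_def)
  ultimately have "midpoint u v \<in> open_segment w (u + v - w)"
    using \<open>midpoint u v \<noteq> w\<close> by (metis midpoint_eq_endpoint(1) midpoint_in_open_segment)
  then have "w \<in> closed_segment u v"
    using face assms(1,4) midpoint_in_closed_segment[of u v]
    by (meson extreme_point_of_def face_ofD)
  with \<open>w \<notin> closed_segment u v\<close> show False
    by contradiction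
qed

text \<open>Vertices and edges of a polytope are certified by supporting functionals. A pair is certified
  not to be an edge by an identity \<open>u + v = w + z\<close> with another vertex \<open>w\<close> and a point \<open>z\<close> of the
  polytope: then the midpoint of the segment also lies between \<open>w\<close> and \<open>z\<close>.\<close>

lemma one_skeleton_convex_hull:
  fixes pt :: "'i \<Rightarrow> 'a::euclidean_space"
  assumes "finite I"
    and vertex: "\<And>i. i \<in> I \<Longrightarrow> \<exists>c. \<forall>k\<in>I. k \<noteq> i \<longrightarrow> c \<bullet> pt k < c \<bullet> pt i"
    and adj: "\<And>i j. i \<in> I \<Longrightarrow> j \<in> I \<Longrightarrow> adj i j \<Longrightarrow> i \<noteq> j \<and>
      (\<exists>c. c \<bullet> pt j = c \<bullet> pt i \<and> (\<forall>k\<in>I. k \<noteq> i \<longrightarrow> k \<noteq> j \<longrightarrow> c \<bullet> pt k < c \<bullet> pt i))"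
    and nonadj: "\<And>i j. i \<in> I \<Longrightarrow> j \<in> I \<Longrightarrow> i \<noteq> j \<Longrightarrow> \<not> adj i j \<Longrightarrow>
      \<exists>k\<in>I. k \<noteq> i \<and> k \<noteq> j \<and> pt i + pt j - pt k \<in> convex hull (pt ` I)"
  shows "graph_isomorphism (labelled_graph I adj) (one_skeleton (convex hull (pt ` I))) pt"
proof -
  let ?P = "convex hull (pt ` I)"
  \<comment> \<open>A functional maximised strictly at one index separates its point from all the
    others.\<close>
  have inj: "inj_on pt I"
    by (rule inj_onI) (metis vertex less_irrefl)
  have extreme: "pt i extreme_point_of ?P" if i: "i \<in> I" for i
  proof -
    obtain c where "\<forall>k\<in>I. k \<noteq> i \<longrightarrow> c \<bullet> pt k < c \<bullet> pt i"
      using vertex[OF i] by blast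
    then have "(convex hull {pt i}) face_of ?P"
      by (intro supporting_hyperplane_face_of_convex_hull[where c = c and \<beta> = "c \<bullet> pt i"])
        (use \<open>finite I\<close> i in auto)
    then show ?thesis
      by (simp add: face_of_singleton)
  qed
  have verts: "{v. v extreme_point_of ?P} = pt ` I"
    using extreme extreme_point_of_convex_hull by blast
  have edge_iff: "closed_segment (pt i) (pt j) edge_of ?P \<longleftrightarrow> adj i j"
    if ij: "i \<in> I" "j \<in> I" "i \<noteq> j" for i j
  proof
    assume edge: "closed_segment (pt i) (pt j) edge_of ?P"
    show "adj i j"
    proof (rule ccontr)
      assume "\<not> adj i j"
      then obtain k where "k \<in> I" "k \<noteq> i" "k \<noteq> j" "pt i + pt j - pt k \<in> ?P"
        using nonadj ij by blast
      then have "\<not> closed_segment (pt i) (pt j) face_of ?P"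
        using ij inj extreme by (intro exchange_not_face_of[where w = "pt k"]) (auto dest: inj_onD)
      then show False
        using edge by (simp add: edge_of_def)
    qed
  next
    assume "adj i j"
    then obtain c where c: "c \<bullet> pt j = c \<bullet> pt i"
      "\<forall>k\<in>I. k \<noteq> i \<longrightarrow> k \<noteq> j \<longrightarrow> c \<bullet> pt k < c \<bullet> pt i"
      using adj ij by blast
    then have "(convex hull {pt i, pt j}) face_of ?P"
      by (intro supporting_hyperplane_face_of_convex_hull[where c = c and \<beta> = "c \<bullet> pt i"])
        (use \<open>finite I\<close> ij in auto)
    moreover have "pt i \<noteq> pt j"
      using ij inj by (auto dest: inj_onD)
    ultimately show "closed_segment (pt i) (pt j) edge_of ?P"
      by (simp add: edge_of_def segment_convex_hull aff_dim_convex_hull aff_dim_2)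
  qed
  have "{{u, v} | u v. closed_segment u v edge_of ?P} =
      {{pt i, pt j} | i j. i \<in> I \<and> j \<in> I \<and> adj i j}" (is "?L = ?R")
  proof
    show "?L \<subseteq> ?R"
    proof
      fix e assume "e \<in> ?L"
      then obtain u v where e: "e = {u, v}" "closed_segment u v edge_of ?P"
        by blast
      then obtain i j where "i \<in> I" "j \<in> I" "u = pt i" "v = pt j" "i \<noteq> j"
        using segment_edge_of_endpoints[OF e(2)] by blast
      then show "e \<in> ?R"
        using e edge_iff by blast
    qed
    show "?R \<subseteq> ?L"
      using edge_iff adj by blast
  qed
  also have "?R = (\<lambda>e. pt ` e) ` {{i, j} | i j. i \<in> I \<and> j \<in> I \<and> adj i j}"
    by (auto simp: image_iff) (metis image_empty image_insert)
  finally show ?thesis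
    using inj verts
    by (simp add: graph_isomorphism_def labelled_graph_def one_skeleton_def bij_betw_def)
qed

section \<open>The regular tetrahedron\<close>

lemma atLeastAtMost_1_4: "{1..4 :: nat} = {1, 2, 3, 4}"
  by auto

definition tet :: "nat \<Rightarrow> real ^ 3" where
  "tet i = (if i = 1 then vector [1, 1, 1] else if i = 2 then vector [1, -1, -1]
            else if i = 3 then vector [-1, 1, -1] else vector [-1, -1, 1])"

lemma tetrahedron_vertices_eq: "tetrahedron_vertices = tet ` {1..4}"
  unfolding atLeastAtMost_1_4 by (simp add: tetrahedron_vertices_def tet_def insert_commute)

text \<open>With these two values every comparison of supporting functionals below becomes a
  question of which indices agree.\<close>

lemma inner_tet:
  "i \<in> {1..4} \<Longrightarrow> j \<in> {1..4} \<Longrightarrow> tet i \<bullet> tet j = (if i = j then 3 else - 1)"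
  unfolding atLeastAtMost_1_4 by (auto simp: tet_def inner_vec_def sum_3)

lemma inj_on_tet: "inj_on tet {1..4}"
proof (rule inj_onI)
  fix i j :: nat assume ij: "i \<in> {1..4}" "j \<in> {1..4}" "tet i = tet j"
  then have "tet i \<bullet> tet i = tet i \<bullet> tet j"
    by simp
  then show "i = j"
    using inner_tet[OF ij(1,1)] inner_tet[OF ij(1,2)] by (auto split: if_splits)
qed

lemma sum_tet:
  assumes "{a, b, c, d} = {1..4}"
  shows "tet a + tet b + tet c + tet d = 0"
proof -
  \<comment> \<open>Four names for the elements of a four-element set are distinct, so the sum over
    the set is the sum of four terms.\<close>
  have "card {a, b, c, d} = 4"
    by (simp add: assms)
  then have "distinct [a, b, c, d]"
    by (intro card_distinct) simp
  then have "tet a + tet b + tet c + tet d = sum tet {a, b, c, d}"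
    by (simp add: add.assoc)
  also have "\<dots> = 0"
    unfolding assms atLeastAtMost_1_4 by (simp add: tet_def vec_eq_iff forall_3)
  finally show ?thesis .
qed

lemma complement_pair:
  assumes "a \<in> {1..4}" "b \<in> {1..4}" "a \<noteq> b"
  obtains c d :: nat where "{a, b, c, d} = {1..4}" "c \<in> {1..4}" "d \<in> {1..4}"
    "c \<noteq> a" "c \<noteq> b" "d \<noteq> a" "d \<noteq> b" "c \<noteq> d"
proof -
  have "card ({1..4} - {a, b}) = 2"
    using assms by (subst card_Diff_subset) auto
  then obtain c d where "{1..4} - {a, b} = {c, d}" "c \<noteq> d"
    by (auto simp: card_2_iff)
  moreover have "{1..4} = {a, b} \<union> ({1..4} - {a, b})"
    using assms by auto
  ultimately have "{a, b, c, d} = {1..4}"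
    by auto
  moreover have "c \<in> {1..4} - {a, b}" "d \<in> {1..4} - {a, b}"
    using \<open>{1..4} - {a, b} = {c, d}\<close> by auto
  ultimately show thesis
    using \<open>c \<noteq> d\<close> that by blast
qed

section \<open>The cube\<close>

text \<open>The bipartite double cover of K_4: a vertex is joined to the opposite sign over every
  other index, and (a, s) and (a, -s) become antipodal vertices of the cube.\<close>

definition cube_labels :: "(nat \<times> int) sgraph" where
  "cube_labels = labelled_graph ({1..4} \<times> {1, - 1}) (\<lambda>(a, s) (b, t). a \<noteq> b \<and> t = - s)"

text \<open>The vertices of the cube with coordinates 1 and -1 are the four tetrahedron vertices,
  where the product of coordinates is 1, and their negatives. The map x \<mapsto> (1 + x)/2 carries
  that cube to the unit cube.\<close>

definition cube_point :: "nat \<times> int \<Rightarrow> real ^ 3" where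
  "cube_point = (\<lambda>(a, s). (1/2) *\<^sub>R (1 + of_int s *\<^sub>R tet a))"

lemma cube_point_image: "cube_point ` ({1..4} \<times> {1, - 1}) = {x. \<forall>i. x $ i = 0 \<or> x $ i = 1}"
  (is "?L = ?R")
proof
  show "?L \<subseteq> ?R"
    unfolding atLeastAtMost_1_4 by (auto simp: cube_point_def tet_def forall_3)
  show "?R \<subseteq> ?L"
  proof
    fix x :: "real ^ 3" assume "x \<in> ?R"
    then have "(x $ 1 = 0 \<or> x $ 1 = 1) \<and> (x $ 2 = 0 \<or> x $ 2 = 1) \<and> (x $ 3 = 0 \<or> x $ 3 = 1)"
      by simp
    then show "x \<in> ?L"
      unfolding atLeastAtMost_1_4
      by (auto simp: cube_point_def tet_def forall_3 vec_eq_iff image_iff Bex_def)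
  qed
qed

text \<open>The term \<open>tet a \<bullet> 1\<close> comes from the shift to the unit cube. It
  depends on the functional only, so it cancels when two points are compared and is left
  unevaluated.\<close>

lemma inner_tet_cube_point:
  "a \<in> {1..4} \<Longrightarrow> b \<in> {1..4} \<Longrightarrow>
    tet a \<bullet> cube_point (b, t) = (tet a \<bullet> 1 + of_int t * (if a = b then 3 else - 1)) / 2"
  by (simp add: cube_point_def inner_add_right inner_tet)

lemma cube_graph_iso: "graph_isomorphism cube_labels cube_graph cube_point"
proof -
  let ?I = "{1..4 :: nat} \<times> {1, - 1 :: int}"
  let ?P = "convex hull (cube_point ` ?I)"
  have "graph_isomorphism cube_labels (one_skeleton ?P) cube_point"
    unfolding cube_labels_def
  proof (rule one_skeleton_convex_hull)
    fix i assume "i \<in> ?I"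
    then obtain a s where i: "i = (a, s)" "a \<in> {1..4}" "s \<in> {1, -1}"
      by blast
    \<comment> \<open>The functional is the direction of the vertex itself: before shift and scaling
      it is 3 there and at most 1 at the other vertices.\<close>
    show "\<exists>c. \<forall>k\<in>?I. k \<noteq> i \<longrightarrow> c \<bullet> cube_point k < c \<bullet> cube_point i"
      by (rule exI[of _ "of_int s *\<^sub>R tet a"])
        (use i in \<open>auto simp: inner_tet_cube_point\<close>)
  next
    fix i j assume "i \<in> ?I" "j \<in> ?I" "(\<lambda>(a, s) (b, t). a \<noteq> b \<and> t = - s) i j"
    then obtain a b s where ij: "i = (a, s)" "j = (b, - s)" "a \<noteq> b"
      and ab: "a \<in> {1..4}" "b \<in> {1..4}" and s: "s = 1 \<or> s = -1"
      by auto
    \<comment> \<open>The functional is the sum of the directions of both ends: before shift and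
      scaling it is 4 at these two, -4 at their antipodes and 0 elsewhere.\<close>
    show "i \<noteq> j \<and> (\<exists>c. c \<bullet> cube_point j = c \<bullet> cube_point i \<and>
        (\<forall>k\<in>?I. k \<noteq> i \<longrightarrow> k \<noteq> j \<longrightarrow> c \<bullet> cube_point k < c \<bullet> cube_point i))"
      by (rule conjI, use ij in simp, rule exI[of _ "of_int s *\<^sub>R (tet a - tet b)"])
        (use ij ab s in \<open>auto simp: inner_tet_cube_point inner_diff_left field_simps\<close>)
  next
    fix i j assume "i \<in> ?I" "j \<in> ?I" "i \<noteq> j" "\<not> (\<lambda>(a, s) (b, t). a \<noteq> b \<and> t = - s) i j"
    moreover obtain a s b t where ij: "i = (a, s)" "j = (b, t)"
      by fastforce
    ultimately have ab: "a \<in> {1..4}" "b \<in> {1..4}" and st: "s \<in> {1, -1}" "t \<in> {1, -1}"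
      and neq: "(a, s) \<noteq> (b, t)" "a = b \<or> t \<noteq> - s"
      by simp_all
    show "\<exists>k\<in>?I. k \<noteq> i \<and> k \<noteq> j \<and> cube_point i + cube_point j - cube_point k \<in> ?P"
    proof (cases "a = b")
      case True
      then have t: "t = - s"
        using neq st by auto
      obtain c :: nat where c: "c \<in> {1..4}" "c \<noteq> a"
        by (cases "a = 1") (auto intro: that[of 1] that[of 2])
      \<comment> \<open>Antipodal points: any other space diagonal has the same midpoint.\<close>
      have "cube_point i + cube_point j - cube_point (c, s) = cube_point (c, - s)"
        by (simp add: ij True t cube_point_def algebra_simps flip: scaleR_add_left)
      then show ?thesis
        using c st ij True t by (intro bexI[of _ "(c, s)"]) (auto intro!: hull_inc)
    next
      case False
      then have t: "t = s"
        using neq st by auto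
      obtain c d where cd: "{a, b, c, d} = {1..4}" "c \<in> {1..4}" "d \<in> {1..4}" "c \<noteq> a" "c \<noteq> b"
        using complement_pair[OF ab False] by metis
      have d: "tet d = - (tet a + tet b + tet c)"
        using sum_tet[OF cd(1)] by (simp only: add_eq_0_iff)
      \<comment> \<open>Points of equal sign are opposite corners of a square face; the other
        diagonal of that face joins the two remaining indices with the opposite sign, because the
        four tetrahedron vertices sum to zero.\<close>
      have "cube_point i + cube_point j - cube_point (c, - s) = cube_point (d, - s)"
        by (simp add: ij t d cube_point_def vec_eq_iff field_simps)
      then show ?thesis
        using cd st ij False t by (intro bexI[of _ "(c, - s)"]) (auto intro!: hull_inc)
    qed
  qed simp
  moreover have "?P = cbox 0 1"
    unfolding cube_point_image Cart_1 unit_interval_convex_hull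
    by (rule arg_cong[where f = "\<lambda>S. convex hull S"]) (simp add: Basis_vec_def inner_axis)
  ultimately show ?thesis
    by (simp add: cube_graph_def)
qed

section \<open>The truncated tetrahedron\<close>

text \<open>The pair (a, b) stands for the cut point near corner a on the edge towards b. Its
  neighbour (b, a) lies on what is left of that edge; its neighbours (a, d) complete the triangle
  cut off at a.\<close>

definition truncated_tetrahedron_labels :: "(nat \<times> nat) sgraph" where
  "truncated_tetrahedron_labels = labelled_graph {(a, b). a \<in> {1..4} \<and> b \<in> {1..4} \<and> a \<noteq> b}
     (\<lambda>(a, b) (c, d). a = d \<and> b = c \<or> a = c \<and> b \<noteq> d)"

definition truncated_tetrahedron_point :: "nat \<times> nat \<Rightarrow> real ^ 3" where
  "truncated_tetrahedron_point = (\<lambda>(a, b). (2/3) *\<^sub>R tet a + (1/3) *\<^sub>R tet b)"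

text \<open>Apart from the constant -1 and in units of 4/3, a match with the first index scores 2
  and a match with the second scores 1, so each functional below amounts to comparing small
  integers.\<close>

lemma inner_tet_truncated_tetrahedron_point:
  "a \<in> {1..4} \<Longrightarrow> b \<in> {1..4} \<Longrightarrow> c \<in> {1..4} \<Longrightarrow> tet a \<bullet> truncated_tetrahedron_point (b, c) =
    (if a = b then 2 else 0) * 4 / 3 + (if a = c then 4/3 else 0) - 1"
  by (simp add: truncated_tetrahedron_point_def inner_add_right inner_tet)

lemma truncated_tetrahedron_graph_iso:
  "graph_isomorphism truncated_tetrahedron_labels truncated_tetrahedron_graph
     truncated_tetrahedron_point"
proof -
  let ?I = "{(a :: nat, b :: nat). a \<in> {1..4} \<and> b \<in> {1..4} \<and> a \<noteq> b}"
  let ?pt = truncated_tetrahedron_point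
  let ?P = "convex hull (?pt ` ?I)"
  note inner = inner_tet_truncated_tetrahedron_point
  have "graph_isomorphism truncated_tetrahedron_labels (one_skeleton ?P) ?pt"
    unfolding truncated_tetrahedron_labels_def
  proof (rule one_skeleton_convex_hull)
    show "finite ?I"
      by (rule finite_subset[of _ "{1..4} \<times> {1..4}"]) auto
  next
    fix i assume "i \<in> ?I"
    then obtain a b where i: "i = (a, b)" "a \<in> {1..4}" "b \<in> {1..4}" "a \<noteq> b"
      by blast
    \<comment> \<open>With weights 2 for a and 1 for b the pair (a, b) scores 5, and every other
      pair at most 4.\<close>
    show "\<exists>c. \<forall>k\<in>?I. k \<noteq> i \<longrightarrow> c \<bullet> ?pt k < c \<bullet> ?pt i"
      by (rule exI[of _ "2 *\<^sub>R tet a + tet b"])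
        (use i in \<open>auto simp: inner inner_add_left\<close>)
  next
    fix i j assume "i \<in> ?I" "j \<in> ?I" and adj: "(\<lambda>(a, b) (c, d). a = d \<and> b = c \<or> a = c \<and> b \<noteq> d) i j"
    moreover obtain a b c d where ij: "i = (a, b)" "j = (c, d)"
      by fastforce
    ultimately have ab: "a \<in> {1..4}" "b \<in> {1..4}" "a \<noteq> b" and cd: "c \<in> {1..4}" "d \<in> {1..4}" "c \<noteq> d"
      by simp_all
    consider "c = b" "d = a" | "c = a" "b \<noteq> d"
      using adj ij by auto
    then show "i \<noteq> j \<and> (\<exists>c. c \<bullet> ?pt j = c \<bullet> ?pt i \<and>
        (\<forall>k\<in>?I. k \<noteq> i \<longrightarrow> k \<noteq> j \<longrightarrow> c \<bullet> ?pt k < c \<bullet> ?pt i))"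
    proof cases
      case 1
      \<comment> \<open>With equal weights, (a, b) and (b, a) score 3 and all other pairs at most
        2.\<close>
      show ?thesis
        by (rule conjI, use ij ab 1 in simp, rule exI[of _ "tet a + tet b"])
          (use ij ab 1 in \<open>auto simp: inner inner_add_left\<close>)
    next
      case 2
      \<comment> \<open>With weights 2 for a and 1 each for b and d, the pairs (a, b) and (a, d)
        score 5 and all others at most 4.\<close>
      show ?thesis
        by (rule conjI, use ij 2 in simp, rule exI[of _ "2 *\<^sub>R tet a + tet b + tet d"])
          (use ij ab cd 2 in \<open>auto simp: inner inner_add_left\<close>)
    qed
  next
    fix i j assume "i \<in> ?I" "j \<in> ?I" "i \<noteq> j"
      and "\<not> (\<lambda>(a, b) (c, d). a = d \<and> b = c \<or> a = c \<and> b \<noteq> d) i j"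
    moreover obtain a b c d where ij: "i = (a, b)" "j = (c, d)"
      by fastforce
    ultimately have abcd: "a \<in> {1..4}" "b \<in> {1..4}" "c \<in> {1..4}" "d \<in> {1..4}"
        "a \<noteq> b" "c \<noteq> d" "a \<noteq> c" "a \<noteq> d \<or> b \<noteq> c"
      by auto
    \<comment> \<open>For distinct indices this is the centre of a hexagonal face, found as the
      midpoint of a long diagonal.\<close>
    have centre: "(1/3) *\<^sub>R (tet x + tet y + tet z) \<in> ?P"
      if "x \<in> {1..4}" "y \<in> {1..4}" "z \<in> {1..4}" "x \<noteq> y" "y \<noteq> z" for x y z
    proof -
      have "midpoint (?pt (x, y)) (?pt (z, y)) \<in> closed_segment (?pt (x, y)) (?pt (z, y))"
        by simp
      also have "closed_segment (?pt (x, y)) (?pt (z, y)) \<subseteq> ?P"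
        using that by (intro closed_segment_subset) (auto intro!: hull_inc)
      also have "midpoint (?pt (x, y)) (?pt (z, y)) = (1/3) *\<^sub>R (tet x + tet y + tet z)"
        by (simp add: midpoint_def truncated_tetrahedron_point_def vec_eq_iff field_simps)
      finally show ?thesis .
    qed
    \<comment> \<open>In the case \<open>b = d\<close> the points are opposite on a hexagon, and
      another long diagonal has the same midpoint. In the cases \<open>a = d\<close> and
      \<open>b = c\<close> they have a common neighbour on a hexagon and span a rhombus with it and
      the centre. When all four indices differ, exchanging the second entries keeps the sum.\<close>
    consider "b = d" | "a = d" | "b = c" | "b \<noteq> d" "a \<noteq> d" "b \<noteq> c"
      by blast
    then show "\<exists>k\<in>?I. k \<noteq> i \<and> k \<noteq> j \<and> ?pt i + ?pt j - ?pt k \<in> ?P"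
    proof cases
      case 1
      have "?pt i + ?pt j - ?pt (a, c) = ?pt (b, c)"
        by (simp add: ij 1 truncated_tetrahedron_point_def vec_eq_iff)
      then show ?thesis
        using 1 ij abcd by (intro bexI[of _ "(a, c)"]) (auto intro!: hull_inc)
    next
      case 2
      have "?pt i + ?pt j - ?pt (a, c) = (1/3) *\<^sub>R (tet a + tet b + tet c)"
        by (simp add: ij 2 truncated_tetrahedron_point_def vec_eq_iff)
      then show ?thesis
        using 2 ij abcd centre[of a b c] by (intro bexI[of _ "(a, c)"]) auto
    next
      case 3
      have "?pt i + ?pt j - ?pt (b, a) = (1/3) *\<^sub>R (tet a + tet b + tet d)"
        by (simp add: ij 3 truncated_tetrahedron_point_def vec_eq_iff)
      then show ?thesis
        using 3 ij abcd centre[of a b d] by (intro bexI[of _ "(b, a)"]) auto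
    next
      case 4
      have "?pt i + ?pt j - ?pt (a, d) = ?pt (c, b)"
        by (simp add: ij truncated_tetrahedron_point_def vec_eq_iff)
      then show ?thesis
        using 4 ij abcd by (intro bexI[of _ "(a, d)"]) (auto intro!: hull_inc)
    qed
  qed
  moreover have "{(2/3) *\<^sub>R a + (1/3) *\<^sub>R b | a b.
      a \<in> tetrahedron_vertices \<and> b \<in> tetrahedron_vertices \<and> a \<noteq> b} = ?pt ` ?I"
    (is "?L = ?R")
  proof
    show "?L \<subseteq> ?R"
      by (auto simp: tetrahedron_vertices_eq truncated_tetrahedron_point_def)
    show "?R \<subseteq> ?L"
    proof
      fix x assume "x \<in> ?R"
      then obtain a b where "x = (2/3) *\<^sub>R tet a + (1/3) *\<^sub>R tet b"
        "a \<in> {1..4}" "b \<in> {1..4}" "a \<noteq> b"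
        by (auto simp: truncated_tetrahedron_point_def)
      moreover from this have "tet a \<noteq> tet b"
        using inj_on_tet by (auto dest: inj_onD)
      ultimately show "x \<in> ?L"
        unfolding tetrahedron_vertices_eq by blast
    qed
  qed
  ultimately show ?thesis
    by (simp add: truncated_tetrahedron_graph_def truncated_tetrahedron_def)
qed

section \<open>Covering maps of graphs\<close>

definition neighbours :: "'a sgraph \<Rightarrow> 'a \<Rightarrow> 'a set" where
  "neighbours X v = {u. {v, u} \<in> edges X}"

lemma edge_endpoints:
  assumes "simple_graph X" "{u, v} \<in> edges X"
  shows "u \<in> verts X" "v \<in> verts X" "u \<noteq> v"
proof -
  obtain a b where "a \<in> verts X" "b \<in> verts X" "a \<noteq> b" "{u, v} = {a, b}"
    using assms unfolding simple_graph_def by blast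
  then show "u \<in> verts X" "v \<in> verts X" "u \<noteq> v"
    by (auto simp: doubleton_eq_iff)
qed

lemma edgeE:
  assumes "simple_graph X" "e \<in> edges X"
  obtains u v where "e = {u, v}" "u \<in> verts X" "v \<in> verts X" "v \<in> neighbours X u"
proof -
  obtain u v where uv: "e = {u, v}" "u \<in> verts X" "v \<in> verts X"
    using assms by (auto simp: simple_graph_def)
  with assms(2) have "v \<in> neighbours X u"
    by (simp add: neighbours_def)
  with uv that show thesis
    by blast
qed

lemma neighbours_subset_verts: "simple_graph X \<Longrightarrow> neighbours X v \<subseteq> verts X"
  by (auto simp: neighbours_def dest: edge_endpoints(2))

lemma bij_betw_incident_edges:
  assumes "simple_graph X"
  shows "bij_betw (\<lambda>u. {v, u}) (neighbours X v) (incident_edges X v)"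
proof -
  have "inj_on (\<lambda>u. {v, u}) (neighbours X v)"
    by (rule inj_onI) (auto simp: doubleton_eq_iff)
  moreover have "incident_edges X v \<subseteq> (\<lambda>u. {v, u}) ` neighbours X v"
  proof
    fix e assume e: "e \<in> incident_edges X v"
    then obtain a b where "e = {a, b}" "v = a \<or> v = b"
      using assms unfolding incident_edges_def simple_graph_def by blast
    with e show "e \<in> (\<lambda>u. {v, u}) ` neighbours X v"
      by (auto simp: incident_edges_def neighbours_def insert_commute)
  qed
  moreover have "(\<lambda>u. {v, u}) ` neighbours X v \<subseteq> incident_edges X v"
    by (auto simp: incident_edges_def neighbours_def)
  ultimately show ?thesis
    by (auto simp: bij_betw_def)
qed

text \<open>In a simple graph an edge at a vertex is determined by its other end, so the condition
  on edges turns into one on vertices; that form in turn implies the morphism property.\<close>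

lemma covering_map_iff_neighbours:
  "covering_map X' X p \<longleftrightarrow> simple_graph X' \<and> simple_graph X \<and> p ` verts X' = verts X \<and>
     (\<forall>v\<in>verts X'. bij_betw p (neighbours X' v) (neighbours X (p v)))" (is "?L \<longleftrightarrow> ?R")
proof -
  have local: "bij_betw (\<lambda>e. p ` e) (incident_edges X' v) (incident_edges X (p v)) \<longleftrightarrow>
      bij_betw p (neighbours X' v) (neighbours X (p v))"
    if simple: "simple_graph X'" "simple_graph X" and "graph_morphism X' X p" for v
  proof -
    have "p ` neighbours X' v \<subseteq> neighbours X (p v)"
    proof (rule image_subsetI)
      fix u assume "u \<in> neighbours X' v"
      then have "p ` {v, u} \<in> edges X"
        using that(3) unfolding graph_morphism_def neighbours_def by blast
      then show "p u \<in> neighbours X (p v)"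
        by (simp add: neighbours_def)
    qed
    then have "bij_betw p (neighbours X' v) (neighbours X (p v)) \<longleftrightarrow>
        bij_betw ((\<lambda>u. {p v, u}) \<circ> p) (neighbours X' v) (incident_edges X (p v))"
      by (rule bij_betw_comp_iff2[OF bij_betw_incident_edges[OF simple(2)]])
    also have "(\<lambda>u. {p v, u}) \<circ> p = (\<lambda>e. p ` e) \<circ> (\<lambda>u. {v, u})"
      by auto
    finally show ?thesis
      by (simp only: bij_betw_comp_iff[OF bij_betw_incident_edges[OF simple(1)]])
  qed
  have morphism: "graph_morphism X' X p"
    if simple: "simple_graph X'" and surj: "p ` verts X' = verts X"
      and bij: "\<forall>v\<in>verts X'. bij_betw p (neighbours X' v) (neighbours X (p v))"
    unfolding graph_morphism_def
  proof (intro conjI ballI)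
    fix v assume "v \<in> verts X'"
    then show "p v \<in> verts X"
      using surj by blast
  next
    fix e assume "e \<in> edges X'"
    then obtain u v where e: "e = {u, v}" "u \<in> verts X'" "v \<in> neighbours X' u"
      using edgeE[OF simple] by blast
    then have "p v \<in> neighbours X (p u)"
      using bij by (auto simp: bij_betw_def)
    then show "p ` e \<in> edges X"
      by (simp add: e neighbours_def)
  qed
  show ?thesis
  proof
    assume L: ?L
    then have "simple_graph X'" "simple_graph X" "graph_morphism X' X p"
      by (simp_all add: covering_map_def)
    note iff = local[OF this]
    from L show ?R
      by (simp add: covering_map_def iff)
  next
    assume ?R
    then have R: "simple_graph X'" "simple_graph X" "p ` verts X' = verts X"
        "\<forall>v\<in>verts X'. bij_betw p (neighbours X' v) (neighbours X (p v))"
      by blast+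
    note m = morphism[OF R(1,3,4)]
    note iff = local[OF R(1,2) m]
    from R m show ?L
      by (simp add: covering_map_def iff)
  qed
qed

text \<open>Lift one end of an edge by surjectivity on vertices and then the edge by the local
  bijection.\<close>

lemma covering_map_edges:
  assumes "covering_map X' X p"
  shows "edges X = (\<lambda>e. p ` e) ` edges X'"
proof
  have simple: "simple_graph X'" "simple_graph X" and surj: "p ` verts X' = verts X"
    and nb: "\<And>v. v \<in> verts X' \<Longrightarrow> p ` neighbours X' v = neighbours X (p v)"
    using assms by (auto simp: covering_map_iff_neighbours bij_betw_def)
  show "edges X \<subseteq> (\<lambda>e. p ` e) ` edges X'"
  proof
    fix e assume "e \<in> edges X"
    then obtain u v where e: "e = {u, v}" "u \<in> verts X" "v \<in> neighbours X u"
      using edgeE[OF simple(2)] by blast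
    then obtain u' where u': "u' \<in> verts X'" "u = p u'"
      using surj by blast
    then obtain v' where "v' \<in> neighbours X' u'" "v = p v'"
      using e nb by blast
    then show "e \<in> (\<lambda>e. p ` e) ` edges X'"
      using e u' by (intro image_eqI[of _ _ "{u', v'}"]) (auto simp: neighbours_def)
  qed
  show "(\<lambda>e. p ` e) ` edges X' \<subseteq> edges X"
    using assms by (auto simp: covering_map_def graph_morphism_def)
qed

lemma covering_map_inj_imp_isomorphism:
  assumes "covering_map X' X p" "inj_on p (verts X')"
  shows "graph_isomorphism X' X p"
proof -
  have "p ` verts X' = verts X"
    using assms(1) by (simp add: covering_map_def)
  then show ?thesis
    using assms(2) covering_map_edges[OF assms(1)]
    by (simp add: graph_isomorphism_def bij_betw_def)
qed

text \<open>The map f descends along q to a bijection of vertices; it respects edges because both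
  edge sets are images of the edges of X.\<close>

lemma covering_maps_same_kernel_imp_isomorphic:
  assumes q: "covering_map X Y q" and f: "covering_map X Z f"
    and kernel: "\<And>u v. u \<in> verts X \<Longrightarrow> v \<in> verts X \<Longrightarrow> q u = q v \<longleftrightarrow> f u = f v"
  shows "isomorphic_graphs Y Z"
proof -
  define h where "h = f \<circ> inv_into (verts X) q"
  have hq: "h (q v) = f v" if "v \<in> verts X" for v
    unfolding h_def o_def using that kernel[of "inv_into (verts X) q (q v)" v]
    by (simp add: inv_into_into f_inv_into_f)
  have surj: "q ` verts X = verts Y" "f ` verts X = verts Z"
    using q f by (simp_all add: covering_map_def)
  have "h ` verts Y = verts Z"
    unfolding surj[symmetric] image_image using hq by simp
  moreover have "inj_on h (verts Y)"
    unfolding surj(1)[symmetric] by (rule inj_onI) (use hq kernel in auto)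
  moreover have "(\<lambda>e. h ` e) ` edges Y = edges Z"
  proof -
    have "h ` q ` e = f ` e" if e: "e \<in> edges X" for e
    proof -
      have "e \<subseteq> verts X"
        using q e by (auto simp: covering_map_def simple_graph_def)
      then show ?thesis
        using hq by (auto simp: image_image subset_iff)
    qed
    then show ?thesis
      by (simp add: covering_map_edges[OF q] covering_map_edges[OF f] image_image)
  qed
  ultimately show ?thesis
    by (auto simp: isomorphic_graphs_def graph_isomorphism_def bij_betw_def)
qed

text \<open>Each vertex of Y has a preimage at which q and p are both bijective on neighbours; hence
  so is r.\<close>

lemma covering_map_right_factor:
  assumes q: "covering_map X' Y q" and p: "covering_map X' X p"
    and factor: "\<And>v. v \<in> verts X' \<Longrightarrow> p v = r (q v)"
  shows "covering_map Y X r"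
proof -
  have surj: "q ` verts X' = verts Y" "p ` verts X' = verts X"
    using q p by (simp_all add: covering_map_def)
  have "r ` verts Y = verts X"
    unfolding surj[symmetric] image_image using factor by simp
  moreover have "bij_betw r (neighbours Y y) (neighbours X (r y))" if y: "y \<in> verts Y" for y
  proof -
    obtain v where v: "v \<in> verts X'" "y = q v"
      using y surj by blast
    have "bij_betw q (neighbours X' v) (neighbours Y y)"
      and "bij_betw p (neighbours X' v) (neighbours X (p v))"
      using q p v by (simp_all add: covering_map_iff_neighbours)
    moreover have "neighbours X' v \<subseteq> verts X'"
      using q by (simp add: covering_map_def neighbours_subset_verts)
    then have "bij_betw p (neighbours X' v) B \<longleftrightarrow> bij_betw (r \<circ> q) (neighbours X' v) B" for B
      using factor by (intro bij_betw_cong) auto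
    ultimately show ?thesis
      using v factor by (simp add: bij_betw_comp_iff)
  qed
  ultimately show ?thesis
    using q p by (simp add: covering_map_iff_neighbours)
qed

lemma covering_map_comp:
  assumes "covering_map X Y q" "covering_map Y Z r"
  shows "covering_map X Z (r \<circ> q)"
proof -
  have q: "simple_graph X" "q ` verts X = verts Y"
      "\<And>v. v \<in> verts X \<Longrightarrow> bij_betw q (neighbours X v) (neighbours Y (q v))"
    and r: "simple_graph Z" "r ` verts Y = verts Z"
      "\<And>v. v \<in> verts Y \<Longrightarrow> bij_betw r (neighbours Y v) (neighbours Z (r v))"
    using assms unfolding covering_map_iff_neighbours by blast+
  have "bij_betw (r \<circ> q) (neighbours X v) (neighbours Z (r (q v)))" if "v \<in> verts X" for v
    using q(3)[OF that] r(3)[of "q v"] q(2) that by (intro bij_betw_trans) auto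
  moreover have "(r \<circ> q) ` verts X = verts Z"
    unfolding image_comp[symmetric] q(2) r(2) ..
  ultimately show ?thesis
    using q(1) r(1) by (simp add: covering_map_iff_neighbours)
qed

text \<open>Simplicity of Y is transported along f, so the polyhedral skeletons turn out to be
  finite simple graphs without any argument about polytopes.\<close>

lemma graph_isomorphism_imp_covering_map:
  assumes "graph_isomorphism X Y f" "simple_graph X"
  shows "covering_map X Y f"
proof -
  have bij: "inj_on f (verts X)" "f ` verts X = verts Y"
    and edges: "edges Y = (\<lambda>e. f ` e) ` edges X"
    using assms by (auto simp: graph_isomorphism_def bij_betw_def)
  have "simple_graph Y"
    unfolding simple_graph_def
  proof
    show "finite (verts Y)"
      using assms bij by (metis finite_imageI simple_graph_def)
    show "\<forall>e\<in>edges Y. \<exists>u\<in>verts Y. \<exists>v\<in>verts Y. u \<noteq> v \<and> e = {u, v}"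
    proof
      fix e assume "e \<in> edges Y"
      then obtain u v where "u \<in> verts X" "v \<in> verts X" "u \<noteq> v" "e = {f u, f v}"
        using assms(2) by (auto simp: edges simple_graph_def)
      then show "\<exists>u\<in>verts Y. \<exists>v\<in>verts Y. u \<noteq> v \<and> e = {u, v}"
        using bij by (metis image_eqI inj_onD)
    qed
  qed
  moreover have "bij_betw f (neighbours X v) (neighbours Y (f v))" if v: "v \<in> verts X" for v
    unfolding bij_betw_def
  proof
    show "inj_on f (neighbours X v)"
      using bij(1) neighbours_subset_verts[OF assms(2)] by (rule inj_on_subset)
    show "f ` neighbours X v = neighbours Y (f v)"
    proof
      show "f ` neighbours X v \<subseteq> neighbours Y (f v)"
      proof (rule image_subsetI)
        fix u assume "u \<in> neighbours X v"
        then have "f ` {v, u} \<in> edges Y"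
          unfolding edges neighbours_def by blast
        then show "f u \<in> neighbours Y (f v)"
          by (simp add: neighbours_def)
      qed
      show "neighbours Y (f v) \<subseteq> f ` neighbours X v"
      proof
        fix w assume "w \<in> neighbours Y (f v)"
        then obtain e where e: "e \<in> edges X" "f ` e = {f v, w}"
          by (auto simp: neighbours_def edges)
        then obtain a b where ab: "e = {a, b}" "a \<in> verts X" "b \<in> verts X"
          using edgeE[OF assms(2)] by blast
        then consider "f a = f v" "f b = w" | "f b = f v" "f a = w"
          using e by (auto simp: doubleton_eq_iff)
        then show "w \<in> f ` neighbours X v"
        proof cases
          case 1
          then have "a = v"
            using ab v bij(1) by (auto dest: inj_onD)
          then show ?thesis
            using 1 ab e by (auto simp: neighbours_def)
        next
          case 2
          then have "b = v"
            using ab v bij(1) by (auto dest: inj_onD)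
          then show ?thesis
            using 2 ab e by (auto simp: neighbours_def insert_commute)
        qed
      qed
    qed
  qed
  ultimately show ?thesis
    using assms(2) bij(2) by (simp add: covering_map_iff_neighbours)
qed

lemma isomorphic_graphs_trans:
  assumes "isomorphic_graphs X Y" "graph_isomorphism Y Z g"
  shows "isomorphic_graphs X Z"
proof -
  obtain f where "graph_isomorphism X Y f"
    using assms(1) unfolding isomorphic_graphs_def by blast
  then have f: "bij_betw f (verts X) (verts Y)" "(\<lambda>e. f ` e) ` edges X = edges Y"
    by (simp_all add: graph_isomorphism_def)
  have g: "bij_betw g (verts Y) (verts Z)" "(\<lambda>e. g ` e) ` edges Y = edges Z"
    using assms(2) by (simp_all add: graph_isomorphism_def)
  have "(\<lambda>e. (g \<circ> f) ` e) ` edges X = edges Z"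
    unfolding g(2)[symmetric] f(2)[symmetric] by (simp add: image_image)
  with bij_betw_trans[OF f(1) g(1)] have "graph_isomorphism X Z (g \<circ> f)"
    by (simp add: graph_isomorphism_def)
  then show ?thesis
    unfolding isomorphic_graphs_def by blast
qed

text \<open>Only q has to be given: r exists because q-fibres lie inside p-fibres. The pair a, b
  keeps q from being an isomorphism, and the pair c, d, separated by q over one base vertex, does so
  for r.\<close>

lemma proper_intermediate_coverI:
  assumes p: "covering_map X' X p" and q: "covering_map X' Y q"
    and factor: "\<And>u v. u \<in> verts X' \<Longrightarrow> v \<in> verts X' \<Longrightarrow> q u = q v \<Longrightarrow> p u = p v"
    and identified: "a \<in> verts X'" "b \<in> verts X'" "a \<noteq> b" "q a = q b"
    and separated: "c \<in> verts X'" "d \<in> verts X'" "p c = p d" "q c \<noteq> q d"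
  shows "\<exists>r. proper_intermediate_cover X' X p Y q r"
proof
  define r where "r = p \<circ> inv_into (verts X') q"
  have r: "p v = r (q v)" if "v \<in> verts X'" for v
    unfolding r_def o_def using that
    by (intro factor) (simp_all add: inv_into_into f_inv_into_f)
  have "covering_map Y X r"
    using q p r by (rule covering_map_right_factor)
  moreover have "\<not> graph_isomorphism X' Y q"
    using identified by (auto simp: graph_isomorphism_def bij_betw_def dest: inj_onD)
  moreover have "\<not> graph_isomorphism Y X r"
  proof
    assume "graph_isomorphism Y X r"
    then have "inj_on r (verts Y)"
      by (simp add: graph_isomorphism_def bij_betw_def)
    moreover have "q c \<in> verts Y" "q d \<in> verts Y"
      using q separated by (auto simp: covering_map_def)
    moreover have "r (q c) = r (q d)"
      using r separated by simp
    ultimately show False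
      using separated by (auto dest: inj_onD)
  qed
  ultimately show "proper_intermediate_cover X' X p Y q r"
    using q r by (simp add: proper_intermediate_cover_def intermediate_cover_def)
qed

text \<open>The orbits are exactly the fibres, and a fibre corresponds to the common value of p on
  it.\<close>

lemma quotient_graph_isomorphic:
  assumes p: "covering_map X' X p"
    and act: "\<And>w. w \<in> verts X \<Longrightarrow> acts_freely_transitively_on G \<phi> (fiber X' p w)"
  shows "isomorphic_graphs (quotient_graph G X' \<phi>) X"
proof -
  have surj: "p ` verts X' = verts X"
    and simple: "simple_graph X'" and simple': "simple_graph X"
    using p by (simp_all add: covering_map_def)
  have orbit: "orbit G \<phi> v = fiber X' p (p v)" if "v \<in> verts X'" for v
  proof -
    have v: "v \<in> fiber X' p (p v)"
      using that by (simp add: fiber_def)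
    have act_v: "acts_freely_transitively_on G \<phi> (fiber X' p (p v))"
      using surj that by (intro act) blast
    show ?thesis
    proof
      show "orbit G \<phi> v \<subseteq> fiber X' p (p v)"
        using act_v v by (auto simp: orbit_def acts_freely_transitively_on_def)
      show "fiber X' p (p v) \<subseteq> orbit G \<phi> v"
      proof
        fix u assume "u \<in> fiber X' p (p v)"
        then obtain g where "g \<in> carrier G" "\<phi> g v = u"
          using act_v v unfolding acts_freely_transitively_on_def by metis
        then show "u \<in> orbit G \<phi> v"
          by (auto simp: orbit_def)
      qed
    qed
  qed
  have orbits: "orbits G (verts X') \<phi> = fiber X' p ` verts X"
    unfolding orbits_def surj[symmetric] using orbit by auto
  have image_fiber: "the_elem (p ` fiber X' p w) = w" if "w \<in> verts X" for w
  proof -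
    obtain v where "v \<in> verts X'" "w = p v"
      using \<open>w \<in> verts X\<close> surj by blast
    then have "p ` fiber X' p w = {w}"
      by (auto simp: fiber_def)
    then show ?thesis
      by simp
  qed
  let ?h = "\<lambda>A. the_elem (p ` A)"
  have "bij_betw ?h (fiber X' p ` verts X) (verts X)"
    by (rule bij_betw_byWitness[where f' = "fiber X' p"]) (auto simp: image_fiber)
  moreover have "(\<lambda>e. ?h ` e) ` edges (quotient_graph G X' \<phi>) = edges X"
  proof
    show "(\<lambda>e. ?h ` e) ` edges (quotient_graph G X' \<phi>) \<subseteq> edges X"
    proof
      fix e assume "e \<in> (\<lambda>e. ?h ` e) ` edges (quotient_graph G X' \<phi>)"
      then obtain A B a b where "A \<in> fiber X' p ` verts X" "B \<in> fiber X' p ` verts X"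
        "e = ?h ` {A, B}" "a \<in> A" "b \<in> B" "{a, b} \<in> edges X'"
        unfolding quotient_graph_def orbits sgraph.simps by blast
      then obtain w w' where "w \<in> verts X" "w' \<in> verts X" "e = ?h ` {fiber X' p w, fiber X' p w'}"
        "a \<in> fiber X' p w" "b \<in> fiber X' p w'" "{a, b} \<in> edges X'"
        by blast
      moreover from this have "p ` {a, b} \<in> edges X"
        using covering_map_edges[OF p] by blast
      ultimately show "e \<in> edges X"
        by (simp add: image_fiber) (simp add: fiber_def)
    qed
    show "edges X \<subseteq> (\<lambda>e. ?h ` e) ` edges (quotient_graph G X' \<phi>)"
    proof
      fix e assume e: "e \<in> edges X"
      then obtain e' where "e' \<in> edges X'" "e = p ` e'"
        using covering_map_edges[OF p] by blast
      moreover then obtain a b where "e' = {a, b}" "a \<in> verts X'" "b \<in> verts X'"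
        using edgeE[OF simple] by blast
      ultimately have ab: "{a, b} \<in> edges X'" "e = {p a, p b}" "a \<in> verts X'" "b \<in> verts X'"
        by auto
      then have w: "p a \<in> verts X" "p b \<in> verts X" "p a \<noteq> p b"
        using e surj edge_endpoints(3)[OF simple', of "p a" "p b"] by auto
      \<comment> \<open>The quotient only joins distinct orbits; no edge is lost, since the ends of
        an edge of X differ and so do their fibres.\<close>
      then have "fiber X' p (p a) \<noteq> fiber X' p (p b)"
        by (metis image_fiber)
      moreover have "a \<in> fiber X' p (p a)" "b \<in> fiber X' p (p b)"
        using ab by (auto simp: fiber_def)
      ultimately have "{fiber X' p (p a), fiber X' p (p b)} \<in> edges (quotient_graph G X' \<phi>)"
        using w ab unfolding quotient_graph_def orbits by auto
      moreover have "e = ?h ` {fiber X' p (p a), fiber X' p (p b)}"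
        using w ab by (simp add: image_fiber)
      ultimately show "e \<in> (\<lambda>e. ?h ` e) ` edges (quotient_graph G X' \<phi>)"
        by (rule image_eqI[rotated])
    qed
  qed
  ultimately have "graph_isomorphism (quotient_graph G X' \<phi>) X ?h"
    by (simp add: graph_isomorphism_def quotient_graph_def orbits)
  then show ?thesis
    unfolding isomorphic_graphs_def by blast
qed

lemma simple_labelled_graph:
  assumes "finite I" "\<And>i. i \<in> I \<Longrightarrow> \<not> adj i i"
  shows "simple_graph (labelled_graph I adj)"
  unfolding simple_graph_def
proof (intro conjI ballI)
  show "finite (verts (labelled_graph I adj))"
    using assms(1) by (simp add: labelled_graph_def)
  fix e assume "e \<in> edges (labelled_graph I adj)"
  then obtain i j where "e = {i, j}" "i \<in> I" "j \<in> I" "adj i j"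
    by (auto simp: labelled_graph_def)
  moreover from this assms(2) have "i \<noteq> j"
    by blast
  ultimately show "\<exists>u\<in>verts (labelled_graph I adj). \<exists>v\<in>verts (labelled_graph I adj).
      u \<noteq> v \<and> e = {u, v}"
    by (auto simp: labelled_graph_def)
qed

lemma neighbours_labelled_graph:
  assumes "\<And>i j. adj i j \<Longrightarrow> adj j i" "i \<in> I"
  shows "neighbours (labelled_graph I adj) i = {j \<in> I. adj i j}"
  using assms by (auto simp: neighbours_def labelled_graph_def doubleton_eq_iff)

section \<open>Covers of the complete graph by the star graph\<close>

definition star_swap :: "nat \<Rightarrow> nat \<Rightarrow> nat" where
  "star_swap i = Transposition.transpose i 4"

lemma star_swap_permutes: "i \<in> {1..3} \<Longrightarrow> star_swap i permutes {1..4}"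
  unfolding star_swap_def by (rule permutes_swap_id) auto

lemma comp_star_swap_star_swap [simp]: "f \<circ> star_swap i \<circ> star_swap i = f"
  by (simp add: star_swap_def comp_assoc)

lemma star_swap_apply:
  "star_swap i 4 = i" "k \<in> {1..3} \<Longrightarrow> star_swap i k = (if k = i then 4 else k)"
  by (auto simp: star_swap_def Transposition.transpose_def)

lemma comp_star_swap_permutes:
  "\<xi> permutes {1..4} \<Longrightarrow> i \<in> {1..3} \<Longrightarrow> \<xi> \<circ> star_swap i permutes {1..4}"
  by (intro permutes_compose star_swap_permutes)

lemma verts_star_graph: "verts star_graph_X3 = {\<xi>. \<xi> permutes {1..4}}"
  by (simp add: star_graph_X3_def cayley_graph_def sym_group_def)

lemma edges_star_graph:
  "edges star_graph_X3 = {{\<xi>, \<xi> \<circ> star_swap i} | \<xi> i. \<xi> permutes {1..4} \<and> i \<in> {1..3}}"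
proof -
  have "{1..3 :: nat} = {1, 2, 3}"
    by auto
  then have swaps:
    "{Transposition.transpose 1 4, Transposition.transpose 2 4, Transposition.transpose 3 4}
      = star_swap ` {1..3}"
    by (simp add: star_swap_def)
  show ?thesis
    unfolding star_graph_X3_def cayley_graph_def sym_group_def swaps
      sgraph.simps monoid.simps partial_object.simps mem_Collect_eq by blast
qed

lemma edges_star_graphE:
  assumes "e \<in> edges star_graph_X3"
  obtains \<xi> i where "e = {\<xi>, \<xi> \<circ> star_swap i}" "\<xi> permutes {1..4}" "i \<in> {1..3}"
  using assms that unfolding edges_star_graph mem_Collect_eq by metis

lemma simple_star_graph: "simple_graph star_graph_X3"
  unfolding simple_graph_def
proof (intro conjI ballI)
  show "finite (verts star_graph_X3)"
    by (simp add: verts_star_graph finite_permutations)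
  fix e assume "e \<in> edges star_graph_X3"
  then obtain \<xi> i where e: "e = {\<xi>, \<xi> \<circ> star_swap i}" "\<xi> permutes {1..4}" "i \<in> {1..3}"
    by (rule edges_star_graphE)
  have "\<xi> 4 \<noteq> (\<xi> \<circ> star_swap i) 4"
    using e(3) inj_eq[OF permutes_inj[OF e(2)]] by (auto simp: star_swap_apply)
  then have "\<xi> \<noteq> \<xi> \<circ> star_swap i"
    by metis
  then show "\<exists>u\<in>verts star_graph_X3. \<exists>v\<in>verts star_graph_X3. u \<noteq> v \<and> e = {u, v}"
    using e(1,2) comp_star_swap_permutes[OF e(2,3)] unfolding verts_star_graph by blast
qed

lemma neighbours_star_graph:
  assumes "\<xi> permutes {1..4}"
  shows "neighbours star_graph_X3 \<xi> = (\<lambda>i. \<xi> \<circ> star_swap i) ` {1..3}"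
proof
  show "neighbours star_graph_X3 \<xi> \<subseteq> (\<lambda>i. \<xi> \<circ> star_swap i) ` {1..3}"
  proof
    fix \<eta> assume "\<eta> \<in> neighbours star_graph_X3 \<xi>"
    then have "{\<xi>, \<eta>} \<in> edges star_graph_X3"
      by (simp add: neighbours_def)
    then obtain \<zeta> i where i: "{\<xi>, \<eta>} = {\<zeta>, \<zeta> \<circ> star_swap i}" "i \<in> {1..3}"
      by (rule edges_star_graphE)
    then have "\<eta> = \<xi> \<circ> star_swap i"
      by (auto simp: doubleton_eq_iff)
    with i show "\<eta> \<in> (\<lambda>i. \<xi> \<circ> star_swap i) ` {1..3}"
      by blast
  qed
  show "(\<lambda>i. \<xi> \<circ> star_swap i) ` {1..3} \<subseteq> neighbours star_graph_X3 \<xi>"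
    using assms unfolding neighbours_def edges_star_graph by blast
qed

lemma bij_betw_neighbours_star_graph:
  assumes "\<xi> permutes {1..4}"
  shows "bij_betw (\<lambda>i. \<xi> \<circ> star_swap i) {1..3} (neighbours star_graph_X3 \<xi>)"
proof -
  have "inj_on (\<lambda>i. \<xi> \<circ> star_swap i) {1..3}"
  proof (rule inj_onI)
    fix i j assume "\<xi> \<circ> star_swap i = \<xi> \<circ> star_swap j"
    then have "(\<xi> \<circ> star_swap i) 4 = (\<xi> \<circ> star_swap j) 4"
      by simp
    then show "i = j"
      using permutes_inj[OF assms] by (auto simp: star_swap_apply dest: injD)
  qed
  then show ?thesis
    by (simp add: bij_betw_def neighbours_star_graph[OF assms])
qed

text \<open>The neighbours of a permutation are indexed by the three generators, so the local
  condition can be checked on {1..3}.\<close>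

lemma star_graph_covering_labelled_graphI:
  assumes I: "finite I" "\<And>i. i \<in> I \<Longrightarrow> \<not> adj i i" "\<And>i j. adj i j \<Longrightarrow> adj j i"
    and f: "\<And>\<xi>. \<xi> permutes {1..4} \<Longrightarrow> f \<xi> \<in> I"
      "\<And>i. i \<in> I \<Longrightarrow> \<exists>\<xi>. \<xi> permutes {1..4} \<and> f \<xi> = i"
    and local: "\<And>\<xi>. \<xi> permutes {1..4} \<Longrightarrow>
      bij_betw (\<lambda>i. f (\<xi> \<circ> star_swap i)) {1..3} {j \<in> I. adj (f \<xi>) j}"
  shows "covering_map star_graph_X3 (labelled_graph I adj) f"
proof -
  have "f ` verts star_graph_X3 = verts (labelled_graph I adj)"
    using f by (auto simp: verts_star_graph labelled_graph_def image_iff)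
  moreover have "bij_betw f (neighbours star_graph_X3 \<xi>) (neighbours (labelled_graph I adj) (f \<xi>))"
    if \<xi>: "\<xi> permutes {1..4}" for \<xi>
    using local[OF \<xi>] bij_betw_comp_iff[OF bij_betw_neighbours_star_graph[OF \<xi>], of f]
    by (simp add: neighbours_labelled_graph[of adj, OF I(3) f(1)[OF \<xi>]] comp_def)
  ultimately show ?thesis
    using simple_star_graph simple_labelled_graph[of I adj, OF I(1,2)]
    by (simp add: covering_map_iff_neighbours verts_star_graph)
qed

text \<open>The common source of the local bijections: the permutation itself matches the three
  generators with the vertices of K_4 other than its image.\<close>

lemma bij_betw_permutes_Diff:
  assumes "\<xi> permutes {1..4 :: nat}"
  shows "bij_betw \<xi> {1..3} ({1..4} - {\<xi> 4})"
proof -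
  have "{1..3 :: nat} = {1..4} - {4}"
    by auto
  then have "\<xi> ` {1..3} = {1..4} - {\<xi> 4}"
    using permutes_image[OF assms] permutes_inj[OF assms] by (simp add: image_set_diff)
  then show ?thesis
    using permutes_inj_on[OF assms] by (simp add: bij_betw_def)
qed

lemma star_graph_covering_K4: "covering_map star_graph_X3 K4 star_proj"
proof -
  have "covering_map star_graph_X3 (labelled_graph {1..4} (\<lambda>i j. i \<noteq> j)) star_proj"
  proof (rule star_graph_covering_labelled_graphI)
    fix \<xi> :: "nat \<Rightarrow> nat" assume \<xi>: "\<xi> permutes {1..4}"
    show "star_proj \<xi> \<in> {1..4}"
      using permutes_in_image[OF \<xi>, of 4] by (simp add: star_proj_def)
    have "{j \<in> {1..4}. star_proj \<xi> \<noteq> j} = {1..4} - {\<xi> 4}"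
      by (auto simp: star_proj_def)
    then show "bij_betw (\<lambda>i. star_proj (\<xi> \<circ> star_swap i)) {1..3} {j \<in> {1..4}. star_proj \<xi> \<noteq> j}"
      using bij_betw_permutes_Diff[OF \<xi>] by (simp add: star_proj_def star_swap_apply)
  next
    fix i :: nat assume "i \<in> {1..4}"
    then have "Transposition.transpose i 4 permutes {1..4}"
      by (intro permutes_swap_id) auto
    then show "\<exists>\<xi>. \<xi> permutes {1..4} \<and> star_proj \<xi> = i"
      by (intro exI[of _ "Transposition.transpose i 4"]) (simp add: star_proj_def)
  qed auto
  moreover have "labelled_graph {1..4} (\<lambda>i j. i \<noteq> j) = K4"
    unfolding K4_def complete_graph_def labelled_graph_def atLeastAtMost_1_4 ..
  ultimately show ?thesis
    by simp
qed

section \<open>The labellings as covering maps\<close>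

definition cube_label :: "(nat \<Rightarrow> nat) \<Rightarrow> nat \<times> int" where
  "cube_label \<xi> = (\<xi> 4, sign \<xi>)"

lemma sign_comp_permutes:
  "p permutes {1..n::nat} \<Longrightarrow> q permutes {1..n} \<Longrightarrow> sign (p \<circ> q) = sign p * sign q"
  by (rule sign_compose) (auto intro: permutes_imp_permutation[rotated])

lemma cube_label_star_swap:
  assumes "\<xi> permutes {1..4}" "i \<in> {1..3}"
  shows "cube_label (\<xi> \<circ> star_swap i) = (\<xi> i, - sign \<xi>)"
  using sign_comp_permutes[OF assms(1) star_swap_permutes[OF assms(2)]] assms(2)
  by (auto simp: cube_label_def star_swap_apply) (auto simp: star_swap_def sign_swap_id)

lemma star_graph_covering_cube_labels: "covering_map star_graph_X3 cube_labels cube_label"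
  unfolding cube_labels_def
proof (rule star_graph_covering_labelled_graphI)
  fix \<xi> :: "nat \<Rightarrow> nat" assume \<xi>: "\<xi> permutes {1..4}"
  have sign: "sign \<xi> \<in> {1, - 1}"
    by (simp add: sign_def)
  then show "cube_label \<xi> \<in> {1..4} \<times> {1, - 1}"
    using permutes_in_image[OF \<xi>, of 4] by (simp add: cube_label_def)
  have target: "{j \<in> {1..4} \<times> {1, - 1}. (case cube_label \<xi> of (a, s) \<Rightarrow> \<lambda>(b, t). a \<noteq> b \<and> t = - s) j} =
      (\<lambda>b. (b, - sign \<xi>)) ` ({1..4} - {\<xi> 4})"
    using sign by (auto simp: cube_label_def)
  have "bij_betw ((\<lambda>b. (b, - sign \<xi>)) \<circ> \<xi>) {1..3} ((\<lambda>b. (b, - sign \<xi>)) ` ({1..4} - {\<xi> 4}))"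
    using bij_betw_permutes_Diff[OF \<xi>]
    by (rule bij_betw_trans) (simp add: bij_betw_def inj_on_def)
  then show "bij_betw (\<lambda>i. cube_label (\<xi> \<circ> star_swap i)) {1..3}
      {j \<in> {1..4} \<times> {1, - 1}. (case cube_label \<xi> of (a, s) \<Rightarrow> \<lambda>(b, t). a \<noteq> b \<and> t = - s) j}"
    unfolding target by (rule bij_betw_cong[THEN iffD1, rotated]) (simp add: cube_label_star_swap[OF \<xi>])
next
  fix i :: "nat \<times> int" assume "i \<in> {1..4} \<times> {1, - 1}"
  then obtain a s where i: "i = (a, s)" "a \<in> {1..4}" "s \<in> {1, - 1}"
    by blast
  \<comment> \<open>Both permutations send 4 to a, and they have opposite signs, so one of them has
    sign s.\<close>
  let ?\<xi> = "Transposition.transpose a 4"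
  let ?\<eta> = "?\<xi> \<circ> Transposition.transpose 1 2"
  have "?\<xi> permutes {1..4}" "Transposition.transpose 1 2 permutes {1..4::nat}"
    using i by (auto intro!: permutes_swap_id)
  then have perm: "?\<xi> permutes {1..4}" "?\<eta> permutes {1..4}" "sign ?\<eta> = - sign ?\<xi>"
    by (auto simp: permutes_compose sign_comp_permutes sign_swap_id)
  have "cube_label ?\<xi> = (a, sign ?\<xi>)" "cube_label ?\<eta> = (a, - sign ?\<xi>)"
    using perm(3) by (simp_all add: cube_label_def)
  moreover have "s = sign ?\<xi> \<or> s = - sign ?\<xi>"
    using i by (auto simp: sign_def)
  ultimately show "\<exists>\<xi>. \<xi> permutes {1..4} \<and> cube_label \<xi> = i"
    using perm i by metis
qed (auto simp: split_beta)

definition truncated_tetrahedron_label :: "nat \<Rightarrow> (nat \<Rightarrow> nat) \<Rightarrow> nat \<times> nat" where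
  "truncated_tetrahedron_label k \<xi> = (\<xi> k, \<xi> 4)"

text \<open>The generator (k,4) exchanges the two entries of the label, which is the step along an
  edge of the tetrahedron; the other two generators replace the second entry only and run through
  the triangle at the corner \<open>\<xi> k\<close>.\<close>

lemma star_graph_covering_truncated_tetrahedron_labels:
  assumes k: "k \<in> {1..3}"
  shows "covering_map star_graph_X3 truncated_tetrahedron_labels (truncated_tetrahedron_label k)"
  unfolding truncated_tetrahedron_labels_def
proof (rule star_graph_covering_labelled_graphI)
  show "finite {(a :: nat, b :: nat). a \<in> {1..4} \<and> b \<in> {1..4} \<and> a \<noteq> b}"
    by (rule finite_subset[of _ "{1..4} \<times> {1..4}"]) auto
next
  fix \<xi> :: "nat \<Rightarrow> nat" assume \<xi>: "\<xi> permutes {1..4}"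
  have inj: "\<xi> i = \<xi> j \<longleftrightarrow> i = j" for i j
    using permutes_inj[OF \<xi>] by (auto dest: injD)
  have range: "\<xi> i \<in> {1..4} \<longleftrightarrow> i \<in> {1..4}" for i
    by (rule permutes_in_image[OF \<xi>])
  show "truncated_tetrahedron_label k \<xi> \<in> {(a, b). a \<in> {1..4} \<and> b \<in> {1..4} \<and> a \<noteq> b}"
    using k range[of k] range[of 4] inj[of k 4] by (auto simp: truncated_tetrahedron_label_def)
  let ?T = "{j \<in> {(a, b). a \<in> {1..4} \<and> b \<in> {1..4} \<and> a \<noteq> b}.
      (case truncated_tetrahedron_label k \<xi> of (a, b) \<Rightarrow> \<lambda>(c, d). a = d \<and> b = c \<or> a = c \<and> b \<noteq> d) j}"
  have label_swap: "truncated_tetrahedron_label k (\<xi> \<circ> star_swap i) = (if i = k then \<xi> 4 else \<xi> k, \<xi> i)"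
    if "i \<in> {1..3}" for i
    using that k by (auto simp: truncated_tetrahedron_label_def star_swap_apply)
  have "inj_on (\<lambda>i. (if i = k then \<xi> 4 else \<xi> k, \<xi> i)) {1..3}"
    by (rule inj_onI) (simp add: inj)
  moreover have "(\<lambda>i. (if i = k then \<xi> 4 else \<xi> k, \<xi> i)) ` {1..3} = ?T" (is "?L = _")
  proof
    show "?L \<subseteq> ?T"
    proof (rule image_subsetI)
      fix i :: nat assume "i \<in> {1..3}"
      then show "(if i = k then \<xi> 4 else \<xi> k, \<xi> i) \<in> ?T"
        using k range[of k] range[of 4] range[of i] by (auto simp: truncated_tetrahedron_label_def inj)
    qed
    show "?T \<subseteq> ?L"
    proof
      fix x assume "x \<in> ?T"
      moreover obtain c d where x: "x = (c, d)"
        by fastforce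
      ultimately have cd: "d \<in> {1..4}" "c \<noteq> d" "\<xi> k = d \<and> \<xi> 4 = c \<or> \<xi> k = c \<and> \<xi> 4 \<noteq> d"
        by (auto simp: truncated_tetrahedron_label_def)
      then have "d \<in> {1..4} - {\<xi> 4}"
        by auto
      then obtain i where i: "i \<in> {1..3}" "d = \<xi> i"
        using bij_betw_permutes_Diff[OF \<xi>] unfolding bij_betw_def by blast
      with cd have "x = (if i = k then \<xi> 4 else \<xi> k, \<xi> i)"
        by (auto simp: x inj)
      with i show "x \<in> ?L"
        by blast
    qed
  qed
  ultimately have "bij_betw (\<lambda>i. (if i = k then \<xi> 4 else \<xi> k, \<xi> i)) {1..3} ?T"
    by (simp only: bij_betw_def simp_thms)
  then show "bij_betw (\<lambda>i. truncated_tetrahedron_label k (\<xi> \<circ> star_swap i)) {1..3} ?T"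
    by (rule bij_betw_cong[THEN iffD1, rotated]) (simp only: label_swap)
next
  fix i :: "nat \<times> nat" assume "i \<in> {(a, b). a \<in> {1..4} \<and> b \<in> {1..4} \<and> a \<noteq> b}"
  then obtain a b where i: "i = (a, b)" "a \<in> {1..4}" "b \<in> {1..4}" "a \<noteq> b"
    by blast
  \<comment> \<open>\<open>?\<tau>\<close> sends 4 to b and, being an involution, sends
    \<open>?\<tau> a\<close> to a. The inner transposition moves that preimage to position k; it
    fixes 4 because a and b differ.\<close>
  let ?\<tau> = "Transposition.transpose b 4"
  let ?\<xi> = "?\<tau> \<circ> Transposition.transpose k (?\<tau> a)"
  have \<tau>: "?\<tau> permutes {1..4}"
    using i by (intro permutes_swap_id) auto
  then have "?\<tau> a \<in> {1..4}"
    using i by (simp only: permutes_in_image)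
  then have "?\<xi> permutes {1..4}"
    using k by (intro permutes_compose[OF permutes_swap_id \<tau>]) auto
  moreover have "?\<tau> a \<noteq> 4"
    using i by (auto simp: Transposition.transpose_def)
  then have "?\<xi> 4 = b"
    using k by (simp add: Transposition.transpose_apply_other)
  moreover have "?\<xi> k = a"
    by simp
  ultimately show "\<exists>\<xi>. \<xi> permutes {1..4} \<and> truncated_tetrahedron_label k \<xi> = i"
    using i by (auto simp: truncated_tetrahedron_label_def)
qed (auto simp: split_beta)

section \<open>Connectedness, subgroups of S_3 and the fibres of an intermediate cover\<close>

declare One_nat_def [simp del]

text \<open>Connectedness of the star graph: the generators yield every transposition, since (a,b) =
  (a,4)(b,4)(a,4).\<close>

lemma star_swap_induct [consumes 1, case_names id swap]:
  assumes "\<xi> permutes {1..4}" and "P id"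
    and step: "\<And>\<xi> i. \<xi> permutes {1..4} \<Longrightarrow> i \<in> {1..3} \<Longrightarrow> P \<xi> \<Longrightarrow> P (\<xi> \<circ> star_swap i)"
  shows "P \<xi>"
proof (rule permutes_rev_induct[where P = P, OF finite_atLeastAtMost assms(1,2)])
  fix a b :: nat and p :: "nat \<Rightarrow> nat"
  assume ab: "a \<in> {1..4}" "b \<in> {1..4}" "a \<noteq> b" and p: "P p" "p permutes {1..4}"
  consider "b = 4" "a \<in> {1..3}" | "a = 4" "b \<in> {1..3}" | "a \<in> {1..3}" "b \<in> {1..3}"
    using ab by fastforce
  then show "P (p \<circ> Transposition.transpose a b)"
  proof cases
    case 1
    then show ?thesis
      using step[OF p(2) _ p(1), of a] by (simp add: star_swap_def)
  next
    case 2
    then show ?thesis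
      using step[OF p(2) _ p(1), of b] by (simp add: star_swap_def transpose_commute)
  next
    case 3
    have "P (p \<circ> star_swap a \<circ> star_swap b \<circ> star_swap a)"
      using 3 p by (intro step comp_star_swap_permutes) auto
    moreover have "star_swap a \<circ> star_swap b \<circ> star_swap a = Transposition.transpose a b"
      using 3 ab by (auto simp: star_swap_def fun_eq_iff Transposition.transpose_def)
    ultimately show ?thesis
      by (simp add: comp_assoc)
  qed
qed

lemma permutes_1_3_imp_permutes_1_4: "\<sigma> permutes {1..3::nat} \<Longrightarrow> \<sigma> permutes {1..4}"
  by (rule permutes_subset) auto

text \<open>Used twice: to describe the fibres of an intermediate cover as cosets, and for
  transitivity of the Galois action.\<close>

lemma inv_comp_permutes_1_3:
  assumes "\<xi> permutes {1..4::nat}" "\<eta> permutes {1..4}" "\<xi> 4 = \<eta> 4"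
  shows "inv' \<xi> \<circ> \<eta> permutes {1..3}"
proof (rule permutes_superset)
  show "inv' \<xi> \<circ> \<eta> permutes {1..4}"
    using assms(1,2) by (intro permutes_compose permutes_inv)
  fix x :: nat assume "x \<in> {1..4} - {1..3}"
  then have "x = 4"
    by auto
  then show "(inv' \<xi> \<circ> \<eta>) x = x"
    using assms(3) permutes_inverses(2)[OF assms(1), of 4] by simp
qed

text \<open>Conjugation by an element of S_3 permutes the three generators. This makes right
  multiplication an automorphism of the star graph and lets edge lifts be compared.\<close>

lemma star_swap_comp:
  assumes "\<sigma> permutes {1..3}" "j \<in> {1..3}"
  shows "star_swap (\<sigma> j) \<circ> \<sigma> = \<sigma> \<circ> star_swap j"
proof -
  have \<sigma>4: "\<sigma> 4 = 4"
    using permutes_not_in[OF assms(1), of 4] by simp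
  have inj: "\<sigma> x = \<sigma> y \<longleftrightarrow> x = y" for x y
    by (rule inj_eq[OF permutes_inj[OF assms(1)]])
  have "\<sigma> x = 4 \<longleftrightarrow> x = 4" for x
    using inj[of x 4] by (simp add: \<sigma>4)
  then show ?thesis
    by (simp add: star_swap_def fun_eq_iff Transposition.transpose_def inj \<sigma>4)
qed

text \<open>In a finite group a submonoid is a subgroup, so inverses come for free. Two distinct
  transpositions produce a 3-cycle, and a 3-cycle together with a transposition produces
  everything.\<close>

lemma submonoid_of_permutes_1_3:
  assumes sub: "H \<subseteq> {\<sigma>. \<sigma> permutes {1..3::nat}}" and "id \<in> H"
    and closed: "\<And>\<sigma> \<tau>. \<sigma> \<in> H \<Longrightarrow> \<tau> \<in> H \<Longrightarrow> \<sigma> \<circ> \<tau> \<in> H"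
  shows "H = {id} \<or> H = {\<sigma>. \<sigma> permutes {1..3}} \<or> H = {\<sigma>. \<sigma> permutes {1..3} \<and> sign \<sigma> = 1} \<or>
    (\<exists>k\<in>{1..3}. H = {\<sigma>. \<sigma> permutes {1..3} \<and> \<sigma> k = k})"
proof -
  \<comment> \<open>The transpositions a, b, c fix 1, 2, 3 respectively; r and s are the two
    3-cycles.\<close>
  define a where "a = Transposition.transpose 2 (3::nat)"
  define b where "b = Transposition.transpose 1 (3::nat)"
  define c where "c = Transposition.transpose 1 (2::nat)"
  define r where "r = c \<circ> a"
  define s where "s = a \<circ> c"
  have set: "{1..3 :: nat} = {1, 2, 3}"
    by auto
  have all: "{\<sigma>. \<sigma> permutes {1..3}} = {id, a, b, c, r, s}"
  proof
    show "{\<sigma>. \<sigma> permutes {1..3}} \<subseteq> {id, a, b, c, r, s}"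
    proof
      fix \<sigma> assume "\<sigma> \<in> {\<sigma>. \<sigma> permutes {1..3::nat}}"
      then have \<sigma>: "\<sigma> permutes {1..3}"
        by simp
      have range: "\<sigma> 1 \<in> {1, 2, 3}" "\<sigma> 2 \<in> {1, 2, 3}" "\<sigma> 3 \<in> {1, 2, 3}"
        using permutes_in_image[OF \<sigma>] unfolding set by simp_all
      have distinct: "\<sigma> 1 \<noteq> \<sigma> 2" "\<sigma> 1 \<noteq> \<sigma> 3" "\<sigma> 2 \<noteq> \<sigma> 3"
        using inj_eq[OF permutes_inj[OF \<sigma>]] by simp_all
      have ext: "\<sigma> = \<tau>" if "\<sigma> 1 = \<tau> 1" "\<sigma> 2 = \<tau> 2" "\<sigma> 3 = \<tau> 3" "\<And>x. x \<notin> {1, 2, 3} \<Longrightarrow> \<tau> x = x" for \<tau>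
      proof
        fix x
        show "\<sigma> x = \<tau> x"
          using that permutes_not_in[OF \<sigma>, of x] unfolding set by (cases "x \<in> {1, 2, 3}") auto
      qed
      consider "\<sigma> 1 = 1" "\<sigma> 2 = 2" "\<sigma> 3 = 3" | "\<sigma> 1 = 1" "\<sigma> 2 = 3" "\<sigma> 3 = 2"
        | "\<sigma> 1 = 3" "\<sigma> 2 = 2" "\<sigma> 3 = 1" | "\<sigma> 1 = 2" "\<sigma> 2 = 1" "\<sigma> 3 = 3"
        | "\<sigma> 1 = 2" "\<sigma> 2 = 3" "\<sigma> 3 = 1" | "\<sigma> 1 = 3" "\<sigma> 2 = 1" "\<sigma> 3 = 2"
        using range distinct by auto
      then have "\<sigma> = id \<or> \<sigma> = a \<or> \<sigma> = b \<or> \<sigma> = c \<or> \<sigma> = r \<or> \<sigma> = s"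
      proof cases
        case 1
        then have "\<sigma> = id"
          by (intro ext) auto
        then show ?thesis by simp
      next
        case 2
        then have "\<sigma> = a"
          by (intro ext) (auto simp: a_def Transposition.transpose_def)
        then show ?thesis by simp
      next
        case 3
        then have "\<sigma> = b"
          by (intro ext) (auto simp: b_def Transposition.transpose_def)
        then show ?thesis by simp
      next
        case 4
        then have "\<sigma> = c"
          by (intro ext) (auto simp: c_def Transposition.transpose_def)
        then show ?thesis by simp
      next
        case 5
        then have "\<sigma> = r"
          by (intro ext) (auto simp: r_def a_def c_def Transposition.transpose_def)
        then show ?thesis by simp
      next
        case 6
        then have "\<sigma> = s"
          by (intro ext) (auto simp: s_def a_def c_def Transposition.transpose_def)
        then show ?thesis by simp
      qed
      then show "\<sigma> \<in> {id, a, b, c, r, s}"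
        by simp
    qed
    have abc: "a permutes {1..3}" "b permutes {1..3}" "c permutes {1..3}"
      unfolding a_def b_def c_def by (auto intro!: permutes_swap_id)
    then have "r permutes {1..3}" "s permutes {1..3}"
      unfolding r_def s_def by (auto intro: permutes_compose)
    with abc show "{id, a, b, c, r, s} \<subseteq> {\<sigma>. \<sigma> permutes {1..3}}"
      by auto
  qed
  have table: "a \<circ> b = r" "b \<circ> c = r" "c \<circ> a = r" "b \<circ> a = s" "c \<circ> b = s" "a \<circ> c = s"
    "r \<circ> r = s" "s \<circ> s = r" "r \<circ> a = c" "r \<circ> b = a" "r \<circ> c = b"
    by (auto simp: r_def s_def a_def b_def c_def fun_eq_iff Transposition.transpose_def)
  have eq: "a 1 = 1" "b 2 = 2" "c 3 = 3" "a 2 \<noteq> 2" "a 3 \<noteq> 3" "b 1 \<noteq> 1" "b 3 \<noteq> 3" "c 1 \<noteq> 1" "c 2 \<noteq> 2"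
    "r 1 \<noteq> 1" "r 2 \<noteq> 2" "r 3 \<noteq> 3" "s 1 \<noteq> 1" "s 2 \<noteq> 2" "s 3 \<noteq> 3"
    by (auto simp: r_def s_def a_def b_def c_def Transposition.transpose_def)
  have sign_abc: "sign a = - 1" "sign b = - 1" "sign c = - 1"
    by (simp_all add: a_def b_def c_def sign_swap_id)
  have sign_rs: "sign r = 1" "sign s = 1"
    by (simp_all add: r_def s_def a_def c_def sign_compose permutation_swap_id sign_swap_id)
  have alt: "{\<sigma>. \<sigma> permutes {1..3} \<and> sign \<sigma> = 1} = {id, r, s}"
  proof -
    have "{\<sigma>. \<sigma> permutes {1..3} \<and> sign \<sigma> = 1} = {\<sigma> \<in> {id, a, b, c, r, s}. sign \<sigma> = 1}"
      unfolding all[symmetric] by simp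
    also have "\<dots> = {id, r, s}"
      using sign_abc sign_rs by auto
    finally show ?thesis .
  qed
  have stab: "{\<sigma>. \<sigma> permutes {1..3} \<and> \<sigma> k = k} = {\<sigma> \<in> {id, a, b, c, r, s}. \<sigma> k = k}" for k
    unfolding all[symmetric] by simp
  have stabs: "{\<sigma>. \<sigma> permutes {1..3} \<and> \<sigma> 1 = 1} = {id, a}"
    "{\<sigma>. \<sigma> permutes {1..3} \<and> \<sigma> 2 = 2} = {id, b}" "{\<sigma>. \<sigma> permutes {1..3} \<and> \<sigma> 3 = 3} = {id, c}"
    unfolding stab using eq by auto
  have H: "H = {id} \<union> (if a \<in> H then {a} else {}) \<union> (if b \<in> H then {b} else {}) \<union>
      (if c \<in> H then {c} else {}) \<union> (if r \<in> H then {r} else {}) \<union> (if s \<in> H then {s} else {})"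
    using sub \<open>id \<in> H\<close> unfolding all by auto
  \<comment> \<open>These entries of the multiplication table leave six of the 32 membership
    patterns, by propositional reasoning alone.\<close>
  have mult: "a \<in> H \<Longrightarrow> b \<in> H \<Longrightarrow> r \<in> H" "b \<in> H \<Longrightarrow> c \<in> H \<Longrightarrow> r \<in> H" "c \<in> H \<Longrightarrow> a \<in> H \<Longrightarrow> r \<in> H"
    "r \<in> H \<Longrightarrow> s \<in> H" "s \<in> H \<Longrightarrow> r \<in> H" "r \<in> H \<Longrightarrow> a \<in> H \<Longrightarrow> c \<in> H" "r \<in> H \<Longrightarrow> b \<in> H \<Longrightarrow> a \<in> H"
    "r \<in> H \<Longrightarrow> c \<in> H \<Longrightarrow> b \<in> H"
    using closed table by metis+
  consider "a \<in> H" "b \<in> H" "c \<in> H" "r \<in> H" "s \<in> H" | "a \<notin> H" "b \<notin> H" "c \<notin> H" "r \<in> H" "s \<in> H"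
    | "a \<notin> H" "b \<notin> H" "c \<notin> H" "r \<notin> H" "s \<notin> H" | "a \<in> H" "b \<notin> H" "c \<notin> H" "r \<notin> H" "s \<notin> H"
    | "a \<notin> H" "b \<in> H" "c \<notin> H" "r \<notin> H" "s \<notin> H" | "a \<notin> H" "b \<notin> H" "c \<in> H" "r \<notin> H" "s \<notin> H"
    using mult by argo
  then show ?thesis
  proof cases
    case 1
    then have "H = {id, a, b, c, r, s}"
      by (subst H) auto
    then show ?thesis
      by (simp add: all)
  next
    case 2
    then have "H = {id, r, s}"
      by (subst H) auto
    then show ?thesis
      by (simp add: alt)
  next
    case 3
    then have "H = {id}"
      by (subst H) auto
    then show ?thesis
      by simp
  next
    case 4
    then have "H = {\<sigma>. \<sigma> permutes {1..3} \<and> \<sigma> 1 = 1}"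
      unfolding stabs by (subst H) auto
    then show ?thesis
      unfolding set by blast
  next
    case 5
    then have "H = {\<sigma>. \<sigma> permutes {1..3} \<and> \<sigma> 2 = 2}"
      unfolding stabs by (subst H) auto
    then show ?thesis
      unfolding set by blast
  next
    case 6
    then have "H = {\<sigma>. \<sigma> permutes {1..3} \<and> \<sigma> 3 = 3}"
      unfolding stabs by (subst H) auto
    then show ?thesis
      unfolding set by blast
  qed
qed

text \<open>Two lifts to \<open>Y\<close> of one edge of \<open>K\<^sub>4\<close> from the same vertex \<open>q (\<xi> \<sigma>) = q \<xi>\<close> coincide.\<close>

lemma intermediate_cover_kernel_right_invariant:
  assumes "intermediate_cover star_graph_X3 K4 star_proj Y q r"
    and \<xi>: "\<xi> permutes {1..4}" and \<sigma>: "\<sigma> permutes {1..3}"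
  shows "q (\<xi> \<circ> \<sigma>) = q \<xi> \<longleftrightarrow> q \<sigma> = q id"
proof -
  have q: "covering_map star_graph_X3 Y q" and r: "covering_map Y K4 r"
    and factor: "\<And>\<xi>. \<xi> permutes {1..4} \<Longrightarrow> r (q \<xi>) = \<xi> 4"
    using assms(1) by (auto simp: intermediate_cover_def verts_star_graph star_proj_def)
  have lift: "q (\<xi> \<circ> star_swap i \<circ> \<sigma>) = q (\<xi> \<circ> star_swap i)"
    if \<xi>: "\<xi> permutes {1..4}" and i: "i \<in> {1..3}" and eq: "q (\<xi> \<circ> \<sigma>) = q \<xi>" for \<xi> i
  proof -
    define j where "j = inv' \<sigma> i"
    have j: "j \<in> {1..3}" "\<sigma> j = i"
      using \<sigma> i by (simp_all only: j_def permutes_in_image[OF permutes_inv[OF \<sigma>]] permutes_inverses)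
    have \<xi>\<sigma>: "\<xi> \<circ> \<sigma> permutes {1..4}"
      by (rule permutes_compose[OF permutes_1_3_imp_permutes_1_4[OF \<sigma>] \<xi>])
    \<comment> \<open>The edge with generator i at \<xi> is carried to the edge with generator j at
      \<xi>\<sigma>; both lead to vertices over \<open>\<xi> i\<close>.\<close>
    have comm: "\<xi> \<circ> star_swap i \<circ> \<sigma> = \<xi> \<circ> \<sigma> \<circ> star_swap j"
      using star_swap_comp[OF \<sigma> j(1)] by (simp add: j(2) comp_assoc)
    have nb: "q (\<eta> \<circ> star_swap k) \<in> neighbours Y (q \<eta>)" if "\<eta> permutes {1..4}" "k \<in> {1..3}" for \<eta> k
    proof -
      have "\<eta> \<circ> star_swap k \<in> neighbours star_graph_X3 \<eta>"
        using that by (simp only: neighbours_star_graph) blast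
      then show ?thesis
        using q that(1) by (auto simp: covering_map_iff_neighbours verts_star_graph bij_betw_def)
    qed
    have "q \<xi> \<in> verts Y"
      using q \<xi> by (auto simp: covering_map_def verts_star_graph)
    then have "inj_on r (neighbours Y (q \<xi>))"
      using r by (simp add: covering_map_iff_neighbours bij_betw_def)
    moreover have "q (\<xi> \<circ> star_swap i) \<in> neighbours Y (q \<xi>)"
      using nb[OF \<xi> i] .
    moreover have "q (\<xi> \<circ> \<sigma> \<circ> star_swap j) \<in> neighbours Y (q \<xi>)"
      using nb[OF \<xi>\<sigma> j(1)] eq by simp
    moreover have "r (q (\<xi> \<circ> \<sigma> \<circ> star_swap j)) = r (q (\<xi> \<circ> star_swap i))"
      by (simp only: factor comp_star_swap_permutes \<xi> \<xi>\<sigma> i j(1)) (simp add: star_swap_apply j(2))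
    ultimately show ?thesis
      unfolding comm by (auto dest: inj_onD)
  qed
  show ?thesis
    using \<xi>
  proof (induction rule: star_swap_induct)
    case id
    show ?case
      by simp
  next
    case (swap \<xi> i)
    \<comment> \<open>The converse direction lifts the same edge backwards, as the generator is an
      involution.\<close>
    have "q (\<xi> \<circ> star_swap i \<circ> \<sigma>) = q (\<xi> \<circ> star_swap i) \<longleftrightarrow> q (\<xi> \<circ> \<sigma>) = q \<xi>"
      using lift[of \<xi> i] lift[of "\<xi> \<circ> star_swap i" i] swap(1,2)
        comp_star_swap_permutes[OF swap(1,2)] by (auto simp only: comp_star_swap_star_swap)
    with swap.IH show ?case
      by blast
  qed
qed

lemma intermediate_cover_isomorphic:
  assumes cover: "proper_intermediate_cover star_graph_X3 K4 star_proj Y q r"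
  shows "isomorphic_graphs Y cube_graph \<or> isomorphic_graphs Y truncated_tetrahedron_graph"
proof -
  have ic: "intermediate_cover star_graph_X3 K4 star_proj Y q r"
    using cover by (simp add: proper_intermediate_cover_def)
  then have q: "covering_map star_graph_X3 Y q" and r: "covering_map Y K4 r"
    and factor: "\<And>\<xi>. \<xi> permutes {1..4} \<Longrightarrow> r (q \<xi>) = \<xi> 4"
    by (auto simp: intermediate_cover_def verts_star_graph star_proj_def)
  define H where "H = {\<sigma>. \<sigma> permutes {1..3} \<and> q \<sigma> = q id}"
  \<comment> \<open>The q-fibre of \<xi> is the left coset \<xi>H.\<close>
  have kernel: "q \<xi> = q \<eta> \<longleftrightarrow> \<xi> 4 = \<eta> 4 \<and> inv' \<xi> \<circ> \<eta> \<in> H"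
    if \<xi>: "\<xi> permutes {1..4}" and \<eta>: "\<eta> permutes {1..4}" for \<xi> \<eta>
  proof (cases "\<xi> 4 = \<eta> 4")
    case True
    then have \<sigma>: "inv' \<xi> \<circ> \<eta> permutes {1..3}"
      by (rule inv_comp_permutes_1_3[OF \<xi> \<eta>])
    have "\<xi> \<circ> (inv' \<xi> \<circ> \<eta>) = \<eta>"
      using permutes_inv_o(1)[OF \<xi>] by (simp flip: comp_assoc)
    then show ?thesis
      using intermediate_cover_kernel_right_invariant[OF ic \<xi> \<sigma>] \<sigma> True by (auto simp: H_def)
  next
    case False
    then show ?thesis
      using factor[OF \<xi>] factor[OF \<eta>] by metis
  qed
  have "H = {id} \<or> H = {\<sigma>. \<sigma> permutes {1..3}} \<or> H = {\<sigma>. \<sigma> permutes {1..3} \<and> sign \<sigma> = 1} \<or>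
    (\<exists>k\<in>{1..3}. H = {\<sigma>. \<sigma> permutes {1..3} \<and> \<sigma> k = k})"
  proof (rule submonoid_of_permutes_1_3)
    fix \<sigma> \<tau> assume "\<sigma> \<in> H" "\<tau> \<in> H"
    then show "\<sigma> \<circ> \<tau> \<in> H"
      using intermediate_cover_kernel_right_invariant[OF ic, of \<sigma> \<tau>]
      by (auto simp: H_def permutes_1_3_imp_permutes_1_4 permutes_compose)
  qed (auto simp: H_def)
  moreover have "H \<noteq> {id}"
  proof
    assume H: "H = {id}"
    have "inj_on q (verts star_graph_X3)"
    proof (rule inj_onI)
      fix \<xi> \<eta> assume "\<xi> \<in> verts star_graph_X3" "\<eta> \<in> verts star_graph_X3" "q \<xi> = q \<eta>"
      then have \<xi>: "\<xi> permutes {1..4}" and "inv' \<xi> \<circ> \<eta> = id"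
        using kernel[of \<xi> \<eta>] by (auto simp: verts_star_graph H)
      then have "\<xi> \<circ> (inv' \<xi> \<circ> \<eta>) = \<xi>"
        by simp
      then show "\<xi> = \<eta>"
        using permutes_inv_o(1)[OF \<xi>] by (simp flip: comp_assoc)
    qed
    then show False
      using cover q covering_map_inj_imp_isomorphism by (auto simp: proper_intermediate_cover_def)
  qed
  moreover have "H \<noteq> {\<sigma>. \<sigma> permutes {1..3}}"
  proof
    assume H: "H = {\<sigma>. \<sigma> permutes {1..3}}"
    have "inj_on r (verts Y)"
    proof (rule inj_onI)
      fix y z assume "y \<in> verts Y" "z \<in> verts Y" and eq: "r y = r z"
      then obtain \<xi> \<eta> where perm: "\<xi> permutes {1..4}" "\<eta> permutes {1..4}" and yz: "y = q \<xi>" "z = q \<eta>"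
        using q unfolding covering_map_def verts_star_graph by blast
      then have "\<xi> 4 = \<eta> 4"
        using eq factor by simp
      then show "y = z"
        using kernel[OF perm] yz inv_comp_permutes_1_3[OF perm] by (simp add: H)
    qed
    then show False
      using cover r covering_map_inj_imp_isomorphism by (auto simp: proper_intermediate_cover_def)
  qed
  ultimately consider "H = {\<sigma>. \<sigma> permutes {1..3} \<and> sign \<sigma> = 1}"
    | k where "k \<in> {1..3}" "H = {\<sigma>. \<sigma> permutes {1..3} \<and> \<sigma> k = k}"
    by blast
  then show ?thesis
  proof cases
    case 1
    have "q \<xi> = q \<eta> \<longleftrightarrow> cube_label \<xi> = cube_label \<eta>"
      if "\<xi> \<in> verts star_graph_X3" "\<eta> \<in> verts star_graph_X3" for \<xi> \<eta>
    proof -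
      have \<xi>: "\<xi> permutes {1..4}" and \<eta>: "\<eta> permutes {1..4}"
        using that by (simp_all add: verts_star_graph)
      have "sign (inv' \<xi> \<circ> \<eta>) = sign \<xi> * sign \<eta>"
        using \<xi> sign_comp_permutes[OF permutes_inv[OF \<xi>] \<eta>]
        by (simp add: sign_inverse permutes_imp_permutation[of "{1..4}"])
      then have "sign (inv' \<xi> \<circ> \<eta>) = 1 \<longleftrightarrow> sign \<xi> = sign \<eta>"
        by (auto simp: sign_def)
      then show ?thesis
        using kernel[OF \<xi> \<eta>] inv_comp_permutes_1_3[OF \<xi> \<eta>] by (auto simp: 1 cube_label_def)
    qed
    then have "isomorphic_graphs Y cube_labels"
      using covering_maps_same_kernel_imp_isomorphic[OF q star_graph_covering_cube_labels] by blast
    then have "isomorphic_graphs Y cube_graph"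
      using cube_graph_iso by (rule isomorphic_graphs_trans)
    then show ?thesis ..
  next
    case 2
    have "q \<xi> = q \<eta> \<longleftrightarrow> truncated_tetrahedron_label k \<xi> = truncated_tetrahedron_label k \<eta>"
      if "\<xi> \<in> verts star_graph_X3" "\<eta> \<in> verts star_graph_X3" for \<xi> \<eta>
    proof -
      have \<xi>: "\<xi> permutes {1..4}" and \<eta>: "\<eta> permutes {1..4}"
        using that by (simp_all add: verts_star_graph)
      have "(inv' \<xi> \<circ> \<eta>) k = k \<longleftrightarrow> \<xi> k = \<eta> k"
        using permutes_inv_eq[OF \<xi>, of "\<eta> k" k] by auto
      then show ?thesis
        using kernel[OF \<xi> \<eta>] inv_comp_permutes_1_3[OF \<xi> \<eta>]
        by (auto simp: 2 truncated_tetrahedron_label_def)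
    qed
    then have "isomorphic_graphs Y truncated_tetrahedron_labels"
      using covering_maps_same_kernel_imp_isomorphic[OF q
          star_graph_covering_truncated_tetrahedron_labels[OF 2(1)]] by blast
    then have "isomorphic_graphs Y truncated_tetrahedron_graph"
      using truncated_tetrahedron_graph_iso by (rule isomorphic_graphs_trans)
    then show ?thesis ..
  qed
qed

text \<open>The witnesses \<sigma> and \<tau> say that the subgroup attached to f is neither trivial
  nor all of S_3.\<close>

lemma exists_proper_intermediate_cover:
  assumes label: "covering_map star_graph_X3 L f" and iso: "graph_isomorphism L Y pt"
    and factor: "\<And>\<xi> \<eta>. f \<xi> = f \<eta> \<Longrightarrow> \<xi> 4 = \<eta> 4"
    and identified: "\<sigma> permutes {1..3}" "\<sigma> \<noteq> id" "f \<sigma> = f id"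
    and separated: "\<tau> permutes {1..3}" "f \<tau> \<noteq> f id"
  shows "\<exists>q r. proper_intermediate_cover star_graph_X3 K4 star_proj Y q r"
proof -
  have simple: "simple_graph L" and surj: "f ` verts star_graph_X3 = verts L"
    using label by (simp_all add: covering_map_def)
  have pt: "pt (f \<xi>) = pt (f \<eta>) \<longleftrightarrow> f \<xi> = f \<eta>"
    if "\<xi> \<in> verts star_graph_X3" "\<eta> \<in> verts star_graph_X3" for \<xi> \<eta>
  proof -
    have "f \<xi> \<in> verts L" "f \<eta> \<in> verts L"
      using that surj by blast+
    then show ?thesis
      using iso by (auto simp: graph_isomorphism_def bij_betw_def dest: inj_onD)
  qed
  have verts: "id \<in> verts star_graph_X3" "\<sigma> \<in> verts star_graph_X3" "\<tau> \<in> verts star_graph_X3"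
    using identified separated permutes_1_3_imp_permutes_1_4 by (auto simp: verts_star_graph permutes_id)
  have "\<tau> 4 = 4"
    using permutes_not_in[OF separated(1), of 4] by simp
  have "\<exists>r. proper_intermediate_cover star_graph_X3 K4 star_proj Y (pt \<circ> f) r"
  proof (rule proper_intermediate_coverI[OF star_graph_covering_K4])
    show "covering_map star_graph_X3 Y (pt \<circ> f)"
      using label graph_isomorphism_imp_covering_map[OF iso simple] by (rule covering_map_comp)
    show "star_proj \<xi> = star_proj \<eta>" if "\<xi> \<in> verts star_graph_X3" "\<eta> \<in> verts star_graph_X3"
        "(pt \<circ> f) \<xi> = (pt \<circ> f) \<eta>" for \<xi> \<eta>
      using that pt factor by (simp add: star_proj_def)
    show "\<sigma> \<noteq> id" "(pt \<circ> f) \<sigma> = (pt \<circ> f) id"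
      using identified by simp_all
    show "star_proj \<tau> = star_proj id" "(pt \<circ> f) \<tau> \<noteq> (pt \<circ> f) id"
      using separated pt verts \<open>\<tau> 4 = 4\<close> by (simp_all add: star_proj_def)
  qed (fact verts)+
  then show ?thesis
    by blast
qed

text \<open>For the alternating group, a 3-cycle lies inside and a transposition outside.\<close>

lemma exists_proper_intermediate_cube_cover:
  "\<exists>q r. proper_intermediate_cover star_graph_X3 K4 star_proj cube_graph q r"
proof (rule exists_proper_intermediate_cover[OF star_graph_covering_cube_labels cube_graph_iso,
      where \<sigma> = "Transposition.transpose 1 2 \<circ> Transposition.transpose 2 3"
        and \<tau> = "Transposition.transpose 1 2"])
  let ?a = "Transposition.transpose 1 (2::nat)" and ?b = "Transposition.transpose 2 (3::nat)"
  show perm: "?a permutes {1..3}"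
    by (rule permutes_swap_id) auto
  have "?b permutes {1..3}"
    by (rule permutes_swap_id) auto
  then show "?a \<circ> ?b permutes {1..3}"
    using perm by (intro permutes_compose)
  have "(?a \<circ> ?b) 1 \<noteq> id 1"
    by (simp add: Transposition.transpose_def)
  then show "?a \<circ> ?b \<noteq> id"
    by metis
  show "cube_label (?a \<circ> ?b) = cube_label id"
    by (simp add: cube_label_def sign_compose permutation_swap_id sign_swap_id Transposition.transpose_def)
  show "cube_label ?a \<noteq> cube_label id"
    by (simp add: cube_label_def sign_swap_id)
qed (simp add: cube_label_def)

text \<open>Here k = 1: the stabiliser of 1 contains the transposition (2,3) and misses
  (1,2).\<close>

lemma exists_proper_intermediate_truncated_tetrahedron_cover:
  "\<exists>q r. proper_intermediate_cover star_graph_X3 K4 star_proj truncated_tetrahedron_graph q r"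
proof (rule exists_proper_intermediate_cover[OF
      star_graph_covering_truncated_tetrahedron_labels truncated_tetrahedron_graph_iso,
      where \<sigma> = "Transposition.transpose 2 3" and \<tau> = "Transposition.transpose 1 2"])
  let ?a = "Transposition.transpose 1 (2::nat)" and ?b = "Transposition.transpose 2 (3::nat)"
  show "(1::nat) \<in> {1..3}"
    by simp
  show "?a permutes {1..3}" "?b permutes {1..3}"
    by (auto intro!: permutes_swap_id)
  show "?b \<noteq> id"
    by (simp add: transpose_eq_id_iff)
  show "truncated_tetrahedron_label 1 ?b = truncated_tetrahedron_label 1 id"
    "truncated_tetrahedron_label 1 ?a \<noteq> truncated_tetrahedron_label 1 id"
    by (simp_all add: truncated_tetrahedron_label_def Transposition.transpose_def)
qed (simp add: truncated_tetrahedron_label_def)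

section \<open>The Galois action of S_3\<close>

lemma right_mult_action_apply:
  assumes "\<sigma> permutes {1..3}" "\<xi> permutes {1..4}"
  shows "right_mult_action \<sigma> \<xi> = \<xi> \<circ> inv' \<sigma>"
  using assms permutes_1_3_imp_permutes_1_4[OF assms(1)]
  by (simp add: right_mult_action_def sym_group_carrier sym_group_mult)

lemma bij_betw_right_mult_action:
  assumes \<sigma>: "\<sigma> permutes {1..3}"
  shows "bij_betw (right_mult_action \<sigma>) {\<xi>. \<xi> permutes {1..4}} {\<xi>. \<xi> permutes {1..4}}"
proof (rule bij_betw_byWitness[where f' = "right_mult_action (inv' \<sigma>)"])
  note action = right_mult_action_apply[OF \<sigma>] right_mult_action_apply[OF permutes_inv[OF \<sigma>]]
  have perm: "\<xi> \<circ> inv' \<sigma> permutes {1..4}" "\<xi> \<circ> \<sigma> permutes {1..4}" if "\<xi> permutes {1..4}" for \<xi>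
    using that permutes_1_3_imp_permutes_1_4[OF \<sigma>]
    by (auto intro: permutes_compose permutes_inv)
  show "\<forall>\<xi>\<in>{\<xi>. \<xi> permutes {1..4}}. right_mult_action (inv' \<sigma>) (right_mult_action \<sigma> \<xi>) = \<xi>"
    "\<forall>\<xi>\<in>{\<xi>. \<xi> permutes {1..4}}. right_mult_action \<sigma> (right_mult_action (inv' \<sigma>) \<xi>) = \<xi>"
    using perm by (simp_all add: action permutes_inv_inv[OF \<sigma>] comp_assoc permutes_inv_o[OF \<sigma>])
  show "right_mult_action \<sigma> ` {\<xi>. \<xi> permutes {1..4}} \<subseteq> {\<xi>. \<xi> permutes {1..4}}"
    "right_mult_action (inv' \<sigma>) ` {\<xi>. \<xi> permutes {1..4}} \<subseteq> {\<xi>. \<xi> permutes {1..4}}"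
    using perm by (auto simp: action permutes_inv_inv[OF \<sigma>])
qed

lemma group_action_right_mult_action:
  "group_action (sym_group 3) (verts star_graph_X3) right_mult_action"
proof -
  let ?V = "{\<xi>. \<xi> permutes {1..4 :: nat}}"
  have Bij: "right_mult_action \<sigma> \<in> Bij ?V" if "\<sigma> permutes {1..3}" for \<sigma>
    using bij_betw_right_mult_action[OF that]
    by (simp add: Bij_def right_mult_action_def sym_group_def)
  have "right_mult_action (\<sigma> \<circ> \<tau>) = compose ?V (right_mult_action \<sigma>) (right_mult_action \<tau>)"
    if \<sigma>: "\<sigma> permutes {1..3}" and \<tau>: "\<tau> permutes {1..3}" for \<sigma> \<tau>
  proof
    fix \<xi>
    show "right_mult_action (\<sigma> \<circ> \<tau>) \<xi> = compose ?V (right_mult_action \<sigma>) (right_mult_action \<tau>) \<xi>"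
    proof (cases "\<xi> permutes {1..4}")
      case True
      have "\<xi> \<circ> inv' \<tau> permutes {1..4}"
        using True permutes_1_3_imp_permutes_1_4[OF permutes_inv[OF \<tau>]] by (rule permutes_compose[rotated])
      then show ?thesis
        using True permutes_compose[OF \<tau> \<sigma>] \<sigma> \<tau>
        by (simp add: compose_def right_mult_action_apply comp_assoc
            o_inv_distrib[OF permutes_bij[OF \<sigma>] permutes_bij[OF \<tau>]])
    next
      \<comment> \<open>Off the vertex set both sides are \<open>undefined\<close>, as the
        extensional functions of \<open>BijGroup\<close> demand.\<close>
      case False
      then show ?thesis
        by (simp add: compose_def right_mult_action_def sym_group_def)
    qed
  qed
  then have "right_mult_action \<in> hom (sym_group 3) (BijGroup ?V)"
    using Bij by (intro homI) (simp_all add: BijGroup_def sym_group_def)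
  then show ?thesis
    unfolding group_action_def group_hom_def group_hom_axioms_def verts_star_graph
    using sym_group_is_group group_BijGroup by blast
qed

lemma graph_isomorphism_right_mult_action:
  assumes \<sigma>: "\<sigma> permutes {1..3}"
  shows "graph_isomorphism star_graph_X3 star_graph_X3 (right_mult_action \<sigma>)"
proof -
  have maps: "right_mult_action \<sigma> ` e \<in> edges star_graph_X3"
    if \<sigma>: "\<sigma> permutes {1..3}" and "e \<in> edges star_graph_X3" for \<sigma> e
  proof -
    obtain \<xi> i where e: "e = {\<xi>, \<xi> \<circ> star_swap i}" and \<xi>: "\<xi> permutes {1..4}" and i: "i \<in> {1..3}"
      using \<open>e \<in> edges star_graph_X3\<close> by (rule edges_star_graphE)
    have j: "\<sigma> i \<in> {1..3}" "inv' \<sigma> (\<sigma> i) = i"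
      using permutes_in_image[OF \<sigma>] permutes_inverses(2)[OF \<sigma>] i by simp_all
    \<comment> \<open>The edge for generator i goes to the edge for generator
      \<open>\<sigma> i\<close>.\<close>
    have "right_mult_action \<sigma> ` e = {\<xi> \<circ> inv' \<sigma>, \<xi> \<circ> inv' \<sigma> \<circ> star_swap (\<sigma> i)}"
      using star_swap_comp[OF permutes_inv[OF \<sigma>] j(1)] comp_star_swap_permutes[OF \<xi> i]
      by (simp add: e right_mult_action_apply \<sigma> \<xi> j(2) comp_assoc)
    moreover have "\<xi> \<circ> inv' \<sigma> permutes {1..4}"
      using \<xi> permutes_1_3_imp_permutes_1_4[OF permutes_inv[OF \<sigma>]] by (rule permutes_compose[rotated])
    ultimately show ?thesis
      unfolding edges_star_graph using j(1) by blast
  qed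
  have bij: "bij_betw (right_mult_action \<sigma>) (verts star_graph_X3) (verts star_graph_X3)"
    using bij_betw_right_mult_action[OF \<sigma>] by (simp add: verts_star_graph)
  \<comment> \<open>An injective self-map of the finite edge set is onto.\<close>
  have "finite (edges star_graph_X3)"
    by (rule finite_subset[of _ "Pow (verts star_graph_X3)"])
      (use simple_star_graph in \<open>auto simp: simple_graph_def\<close>)
  moreover have "inj_on (\<lambda>e. right_mult_action \<sigma> ` e) (edges star_graph_X3)"
    by (rule inj_on_subset[OF inj_on_image_Pow[OF bij_betw_imp_inj_on[OF bij]]])
      (use simple_star_graph in \<open>auto simp: simple_graph_def\<close>)
  ultimately have "(\<lambda>e. right_mult_action \<sigma> ` e) ` edges star_graph_X3 = edges star_graph_X3"
    using maps[OF \<sigma>] by (intro endo_inj_surj) auto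
  with bij show ?thesis
    by (simp add: graph_isomorphism_def)
qed

lemma right_mult_action_free_transitive:
  "acts_freely_transitively_on (sym_group 3) right_mult_action (fiber star_graph_X3 star_proj w)"
  unfolding acts_freely_transitively_on_def
proof (intro conjI ballI impI)
  fix \<sigma> \<xi> assume "\<sigma> \<in> carrier (sym_group 3)" "\<xi> \<in> fiber star_graph_X3 star_proj w"
  then have \<sigma>: "\<sigma> permutes {1..3}" and \<xi>: "\<xi> permutes {1..4}" "\<xi> 4 = w"
    by (simp_all add: sym_group_carrier fiber_def verts_star_graph star_proj_def)
  have "inv' \<sigma> 4 = 4"
    using permutes_not_in[OF permutes_inv[OF \<sigma>], of 4] by simp
  moreover have "\<xi> \<circ> inv' \<sigma> permutes {1..4}"
    using \<xi>(1) permutes_1_3_imp_permutes_1_4[OF permutes_inv[OF \<sigma>]] by (rule permutes_compose[rotated])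
  ultimately show "right_mult_action \<sigma> \<xi> \<in> fiber star_graph_X3 star_proj w"
    using \<sigma> \<xi> by (simp add: fiber_def verts_star_graph star_proj_def right_mult_action_apply)
  assume "right_mult_action \<sigma> \<xi> = \<xi>"
  then have "\<xi> \<circ> inv' \<sigma> \<circ> \<sigma> = \<xi> \<circ> \<sigma>"
    using \<sigma> \<xi> by (simp add: right_mult_action_apply)
  then have "\<xi> (\<sigma> x) = \<xi> x" for x
    using permutes_inv_o(2)[OF \<sigma>] by (metis comp_apply comp_assoc comp_id)
  then show "\<sigma> = \<one>\<^bsub>sym_group 3\<^esub>"
    using inj_eq[OF permutes_inj[OF \<xi>(1)]] by (auto simp: sym_group_one)
next
  fix \<xi> \<eta> assume "\<xi> \<in> fiber star_graph_X3 star_proj w" "\<eta> \<in> fiber star_graph_X3 star_proj w"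
  then have \<xi>: "\<xi> permutes {1..4}" and \<eta>: "\<eta> permutes {1..4}" and eq: "\<eta> 4 = \<xi> 4"
    by (simp_all add: fiber_def verts_star_graph star_proj_def)
  have \<sigma>: "inv' \<eta> \<circ> \<xi> permutes {1..3}"
    using inv_comp_permutes_1_3[OF \<eta> \<xi> eq] .
  \<comment> \<open>The action multiplies by the inverse, so the element taking \<xi> to \<eta> is
    the inverse of \<eta> times \<xi>.\<close>
  have "\<xi> \<circ> inv' (inv' \<eta> \<circ> \<xi>) = \<eta>"
    using permutes_inv_o(1)[OF \<xi>] permutes_inv_inv[OF \<eta>]
    by (simp add: o_inv_distrib permutes_bij[OF \<xi>] permutes_bij[OF permutes_inv[OF \<eta>]] flip: comp_assoc)
  then show "\<exists>\<sigma>\<in>carrier (sym_group 3). right_mult_action \<sigma> \<xi> = \<eta>"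
    using \<sigma> \<xi> by (intro bexI[of _ "inv' \<eta> \<circ> \<xi>"]) (simp_all add: right_mult_action_apply sym_group_carrier)
qed

lemma galois_cover_star_graph:
  "galois_cover (sym_group 3) right_mult_action star_graph_X3 K4 star_proj"
  unfolding galois_cover_def graph_action_def
  using star_graph_covering_K4 group_action_right_mult_action graph_isomorphism_right_mult_action
    right_mult_action_free_transitive
    quotient_graph_isomorphic[OF star_graph_covering_K4 right_mult_action_free_transitive]
  by (simp add: sym_group_carrier)

theorem theorem5:
  shows "galois_cover (sym_group 3) right_mult_action star_graph_X3 K4 star_proj
    \<and> (\<forall>(Y :: 'c sgraph) q r. proper_intermediate_cover star_graph_X3 K4 star_proj Y q r
          \<longrightarrow> isomorphic_graphs Y cube_graph \<or> isomorphic_graphs Y truncated_tetrahedron_graph)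
    \<and> (\<exists>q r. proper_intermediate_cover star_graph_X3 K4 star_proj cube_graph q r)
    \<and> (\<exists>q r. proper_intermediate_cover star_graph_X3 K4 star_proj truncated_tetrahedron_graph q r)"
  using galois_cover_star_graph intermediate_cover_isomorphic exists_proper_intermediate_cube_cover
    exists_proper_intermediate_truncated_tetrahedron_cover by blast

end
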